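(* Let $\mathbf X_n(\mathbf x)$ be the process $\mathbf X_{n+1}=\mathbf A_{n+1}\mathbf X_n+\mathbf B_{n+1}$ on $\mathbb R^d$ started at $\mathbf x$, driven by i.i.d. copies $(\mathbf A_n,\mathbf B_n)_{n\ge 1}$ of $(\mathbf A,\mathbf B)$. Assume: (a) $\gamma_L>0$, where almost surely $\lim_n\frac1n\log\|\Pi_n\|=\gamma_L$; (b) $\mathbb P(\mathbf A\text{ is singular})=0$, and $\mathbf A$ is irreducible, i.e. there is no proper nontrivial subspace $V$ of $\mathbb R^d$ such that $\mathbf AV\subset V$ almost surely; (c) $\inf_{\mathbf x\in\mathbb R^d}\mathbb E\log|\mathbf A\mathbf x+\mathbf B-\mathbf x|>-\infty$; (d) there are $R_0,z_0>1$, $C_0>0$ and $\beta_0>1$ such that $\mathbb P(|\mathbf A\mathbf x+\mathbf B|>zR)\le\frac{C_0}{(\log z)^{\beta_0}}\mathbb P(|\mathbf A\mathbf x+\mathbf B|>R)$ for all $R\ge R_0$, $z\ge z_0$ and $\mathbf x$ with $|\mathbf x|\le R$. Then for all $\mathbf x_0\in\mathbb R^d$, $$\frac1{\gamma_L}\le\liminf_{R\to\infty}\frac{\mathbb E[\tau_R(\mathbf x_0)]}{\log R}\le\limsup_{R\to\infty}\frac{\mathbb E[\tau_R(\mathbf x_0)]}{\log R}<\infty .$$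
   Context: Let $d\ge1$, let $\mathbf A$ be a random real $d\times d$ matrix and $\mathbf B$ a random vector in $\mathbb R^d$ (possibly dependent), and let $(\mathbf A_n,\mathbf B_n)_{n\ge1}$ be i.i.d. copies of the pair $(\mathbf A,\mathbf B)$. For $\mathbf x\in\mathbb R^d$: $\mathbf X_0(\mathbf x)=\mathbf x$, $\mathbf X_{n+1}(\mathbf x)=\mathbf A_{n+1}\mathbf X_n(\mathbf x)+\mathbf B_{n+1}$. $|\cdot|$ is the Euclidean norm, $\|\mathbf M\|=\sup_{|\mathbf x|=1}|\mathbf M\mathbf x|$, $\Pi_n=\mathbf A_n\mathbf A_{n-1}\cdots\mathbf A_1$. The Lyapunov exponent is $\gamma_L=\lim_{n}\frac1n\mathbb E\log\|\Pi_n\|$ (which is also the a.s. limit of $\frac1n\log\|\Pi_n\|$). The exit time is $\tau_R(\mathbf x)=\inf\{n\ge0:|\mathbf X_n(\mathbf x)|>R\}$ with $\inf\emptyset=\infty$. *)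

theory Defs
  imports "HOL-Probability.Probability"
begin

text \<open>
  The logarithm of a nonnegative real with \<open>log 0 = -\<infinity>\<close>; the library's \<^const>\<open>ln\<close> has
  \<open>ln 0 = 0\<close>.
\<close>

definition elog :: "real \<Rightarrow> ereal" where
  "elog r = (if r = 0 then - \<infinity> else ereal (ln r))"

text \<open>
  Expectation with values in \<open>[-\<infinity>, \<infinity>]\<close>: the integral of the positive part minus that of the
  negative part.  It is meaningful only if at least one of the two is finite; on
  \<^typ>\<open>ereal\<close> the difference \<open>\<infinity> - \<infinity>\<close> is \<open>\<infinity>\<close>.
\<close>

definition ereal_expectation :: "'a measure \<Rightarrow> ('a \<Rightarrow> ereal) \<Rightarrow> ereal" where
  "ereal_expectation M f =
     enn2ereal (\<integral>\<^sup>+ \<omega>. e2ennreal (f \<omega>) \<partial>M) - enn2ereal (\<integral>\<^sup>+ \<omega>. e2ennreal (- f \<omega>) \<partial>M)"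

text \<open>
  Independent copies are indexed by \<open>n \<ge> 1\<close>; the values at index \<open>0\<close> play no role.  The two
  components of a pair may depend on each other.
\<close>

definition iid_copies ::
  "'a measure \<Rightarrow> ('a \<Rightarrow> 'b::topological_space) \<Rightarrow> (nat \<Rightarrow> 'a \<Rightarrow> 'b) \<Rightarrow> bool" where
  "iid_copies M Z Zs \<longleftrightarrow>
     prob_space.indep_vars M (\<lambda>_. borel) Zs {1..} \<and>
     (\<forall>n\<ge>1. distr M borel (Zs n) = distr M borel Z)"

primrec affine_process ::
  "(nat \<Rightarrow> 'a \<Rightarrow> real^'n^'n) \<Rightarrow> (nat \<Rightarrow> 'a \<Rightarrow> real^'n) \<Rightarrow> real^'n \<Rightarrow> nat \<Rightarrow> 'a \<Rightarrow> real^'n" where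
  "affine_process As Bs x 0 \<omega> = x"
| "affine_process As Bs x (Suc n) \<omega> =
     As (Suc n) \<omega> *v affine_process As Bs x n \<omega> + Bs (Suc n) \<omega>"

primrec left_product :: "(nat \<Rightarrow> 'a \<Rightarrow> real^'n^'n) \<Rightarrow> nat \<Rightarrow> 'a \<Rightarrow> real^'n^'n" where
  "left_product As 0 \<omega> = mat 1"
| "left_product As (Suc n) \<omega> = As (Suc n) \<omega> ** left_product As n \<omega>"

text \<open>
  The spectral norm is \<^const>\<open>onorm\<close> of the associated linear map; \<^const>\<open>norm\<close> on
  matrices is the Frobenius norm.
\<close>

definition log_growth :: "(nat \<Rightarrow> 'a \<Rightarrow> real^'n^'n) \<Rightarrow> nat \<Rightarrow> 'a \<Rightarrow> ereal" where
  "log_growth As n \<omega> = elog (onorm ((*v) (left_product As n \<omega>)))"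

definition lyapunov_exponent :: "'a measure \<Rightarrow> (nat \<Rightarrow> 'a \<Rightarrow> real^'n^'n) \<Rightarrow> ereal" where
  "lyapunov_exponent M As =
     lim (\<lambda>n. ereal_expectation M (log_growth As n) / ereal (real n))"

definition irreducible_matrix :: "'a measure \<Rightarrow> ('a \<Rightarrow> real^'n^'n) \<Rightarrow> bool" where
  "irreducible_matrix M A \<longleftrightarrow>
     \<not> (\<exists>V. subspace V \<and> V \<noteq> {0} \<and> V \<noteq> UNIV \<and> (AE \<omega> in M. (*v) (A \<omega>) ` V \<subseteq> V))"

text \<open>The infimum of the empty set in \<^typ>\<open>enat\<close> is \<open>\<infinity>\<close>.\<close>

definition exit_time ::
  "(nat \<Rightarrow> 'a \<Rightarrow> real^'n^'n) \<Rightarrow> (nat \<Rightarrow> 'a \<Rightarrow> real^'n) \<Rightarrow> real \<Rightarrow> real^'n \<Rightarrow> 'a \<Rightarrow> enat" where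
  "exit_time As Bs R x \<omega> = (INF n\<in>{n. norm (affine_process As Bs x n \<omega>) > R}. enat n)"

definition expected_exit_time ::
  "'a measure \<Rightarrow> (nat \<Rightarrow> 'a \<Rightarrow> real^'n^'n) \<Rightarrow> (nat \<Rightarrow> 'a \<Rightarrow> real^'n) \<Rightarrow> real \<Rightarrow> real^'n \<Rightarrow> ennreal" where
  "expected_exit_time M As Bs R x = (\<integral>\<^sup>+ \<omega>. ennreal_of_enat (exit_time As Bs R x \<omega>) \<partial>M)"

end

theory Submission
  imports Defs
begin

text \<open>
  Write \<open>X\<^sub>n\<close> for the process and \<open>\<Pi>\<^sub>n\<close> for the matrix products.

  Upper bound: \<open>X\<^sub>n\<^sub>+\<^sub>1\<close> minus the process driven by the environment shifted by one step is
  \<open>\<Pi>\<^sub>n\<close> of the shifted environment, applied to the independent vector \<open>A\<^sub>1 x + B\<^sub>1 - x\<close>. The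
  latter is bounded away from \<open>0\<close> in probability, uniformly in \<open>x\<close>, because there is no fixed
  point. By irreducibility and compactness, one of \<open>\<Pi>\<^sub>N, \<dots>, \<Pi>\<^sub>N\<^sub>+\<^sub>m\<close> (with \<open>m\<close> fixed) expands a
  given direction at rate \<open>c < \<gamma>\<close> with positive probability. Hence the ball of radius \<open>R\<close> is
  left within \<open>O(log R)\<close> steps with a probability bounded below uniformly in the starting
  point, and independent trials give \<open>E \<tau>\<^sub>R = O(log R)\<close>.

  Lower bound: the tail condition makes \<open>log (1 + |A| + |B|)\<close> integrable, and then, for every
  \<open>b > \<gamma>\<close>, with probability close to \<open>1\<close> the process stays below \<open>exp (b n)\<close> up to time \<open>n\<close>.
\<close>

text \<open>Two orbits in one environment differ by a product applied to the difference of their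
  starts, so expansion by itself only forces one of two different starts out of the ball, whereas
  independent trials need a bound for every single start. The shift removes this defect: both
  compared processes start at the same \<open>x\<close>, hence are equally likely to leave, and the
  price is one random displacement, independent of the product acting on it. That displacement must
  be controlled for all \<open>x\<close> at once, also near infinity, where only the direction of
  \<open>x\<close> counts and a vanishing displacement means a vector fixed by the linear part.
  Sizes in this half are measured by expectations of \<open>min 1 (norm ...)\<close>: they depend
  continuously on parameters without moment assumptions and vanish only for functions that are zero
  almost surely, so compactness turns qualitative statements into constants. The growth rate is
  known almost surely, hence in probability, but with no speed of convergence. The upper bound
  therefore works with an event of probability above 1/2.\<close>

section \<open>Continuity, measurability and norms of matrix products\<close>

lemma continuous_on_matrix_vector_mult [continuous_intros]:
  fixes f :: "'a::topological_space \<Rightarrow> real^'m^'n" and g :: "'a \<Rightarrow> real^'m"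
  assumes "continuous_on S f" "continuous_on S g"
  shows "continuous_on S (\<lambda>x. f x *v g x)"
  unfolding matrix_vector_mult_def
  by (intro continuous_on_vec_lambda continuous_intros assms)

lemma continuous_on_matrix_matrix_mult [continuous_intros]:
  fixes f :: "'a::topological_space \<Rightarrow> real^'m^'n" and g :: "'a \<Rightarrow> real^'k^'m"
  assumes "continuous_on S f" "continuous_on S g"
  shows "continuous_on S (\<lambda>x. f x ** g x)"
  unfolding matrix_matrix_mult_def
  by (intro continuous_on_vec_lambda continuous_intros assms)

lemma borel_measurable_matrix_vector_mult [measurable (raw)]:
  fixes f :: "'a \<Rightarrow> real^'m^'n" and g :: "'a \<Rightarrow> real^'m"
  assumes "f \<in> borel_measurable M" "g \<in> borel_measurable M"
  shows "(\<lambda>x. f x *v g x) \<in> borel_measurable M"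
  by (rule borel_measurable_continuous_Pair[OF assms]) (intro continuous_intros)

lemma borel_measurable_matrix_matrix_mult [measurable (raw)]:
  fixes f :: "'a \<Rightarrow> real^'m^'n" and g :: "'a \<Rightarrow> real^'k^'m"
  assumes "f \<in> borel_measurable M" "g \<in> borel_measurable M"
  shows "(\<lambda>x. f x ** g x) \<in> borel_measurable M"
  by (rule borel_measurable_continuous_Pair[OF assms]) (intro continuous_intros)

lemma norm_matrix_vector_mult_le:
  fixes A :: "real^'m^'n"
  shows "norm (A *v x) \<le> norm A * norm x"
proof -
  have "norm (A *v x) = L2_set (\<lambda>i. norm ((A *v x) $ i)) UNIV"
    by (simp add: norm_vec_def)
  also have "\<dots> \<le> L2_set (\<lambda>i. norm (A $ i) * norm x) UNIV"
    by (intro L2_set_mono) (auto simp: matrix_vector_mul_component intro: Cauchy_Schwarz_ineq2)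
  also have "\<dots> = norm A * norm x"
    by (simp add: norm_vec_def[of A] L2_set_left_distrib)
  finally show ?thesis .
qed

lemma onorm_le_norm_matrix: "onorm ((*v) (A :: real^'m^'n)) \<le> norm A"
  by (intro onorm_le norm_matrix_vector_mult_le)

text \<open>Each entry is bounded by the operator norm. The crude factor is harmless because only
  exponential rates matter, so the Frobenius norm can stand in for the spectral norm
  throughout.\<close>

lemma norm_matrix_le_onorm:
  "norm (A :: real^'m^'n) \<le> real CARD('n) * real CARD('m) * onorm ((*v) A)"
proof -
  have "norm A \<le> (\<Sum>i\<in>UNIV. norm (A $ i))"
    unfolding norm_vec_def[of A] by (rule L2_set_le_sum) simp
  also have "\<dots> \<le> (\<Sum>i\<in>(UNIV :: 'n set). \<Sum>j\<in>(UNIV :: 'm set). \<bar>A $ i $ j\<bar>)"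
    by (intro sum_mono norm_le_l1_cart)
  also have "\<dots> \<le> (\<Sum>i\<in>(UNIV :: 'n set). \<Sum>j\<in>(UNIV :: 'm set). onorm ((*v) A))"
    by (intro sum_mono matrix_component_le_onorm)
  finally show ?thesis by simp
qed

section \<open>Orbits and matrix products on the space of environments\<close>

type_synonym 'n affine_map = "(real^'n^'n) \<times> (real^'n)"

text \<open>Coordinate \<open>n\<close> drives step \<open>n + 1\<close>, so environments are
  indexed from 0 although the copies in the theorem are indexed from 1.\<close>

primrec orbit :: "real^'n \<Rightarrow> nat \<Rightarrow> (nat \<Rightarrow> 'n affine_map) \<Rightarrow> real^'n" where
  "orbit x 0 \<omega> = x"
| "orbit x (Suc n) \<omega> = fst (\<omega> n) *v orbit x n \<omega> + snd (\<omega> n)"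

primrec cocycle :: "nat \<Rightarrow> (nat \<Rightarrow> 'n affine_map) \<Rightarrow> real^'n^'n" where
  "cocycle 0 \<omega> = mat 1"
| "cocycle (Suc n) \<omega> = fst (\<omega> n) ** cocycle n \<omega>"

definition shift :: "nat \<Rightarrow> (nat \<Rightarrow> 'a) \<Rightarrow> nat \<Rightarrow> 'a" where
  "shift m \<omega> i = \<omega> (m + i)"

lemma shift_comb_seq [simp]: "shift m (comb_seq m \<omega> \<omega>') = \<omega>'"
  by (auto simp: shift_def comb_seq_def)

lemma shift_shift [simp]: "shift m (shift k \<omega>) = shift (k + m) \<omega>"
  by (auto simp: shift_def add.assoc)

lemma shift_0 [simp]: "shift 0 \<omega> = \<omega>"
  by (auto simp: shift_def)

lemma orbit_cong: "(\<And>i. i < n \<Longrightarrow> \<omega> i = \<omega>' i) \<Longrightarrow> orbit x n \<omega> = orbit x n \<omega>'"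
  by (induction n) auto

lemma cocycle_cong: "(\<And>i. i < n \<Longrightarrow> \<omega> i = \<omega>' i) \<Longrightarrow> cocycle n \<omega> = cocycle n \<omega>'"
  by (induction n) auto

lemma orbit_comb_seq [simp]: "n \<le> m \<Longrightarrow> orbit x n (comb_seq m \<omega> \<omega>') = orbit x n \<omega>"
  by (rule orbit_cong) (auto simp: comb_seq_def)

lemma cocycle_comb_seq [simp]: "n \<le> m \<Longrightarrow> cocycle n (comb_seq m \<omega> \<omega>') = cocycle n \<omega>"
  by (rule cocycle_cong) (auto simp: comb_seq_def)

lemma orbit_add: "orbit x (m + n) \<omega> = orbit (orbit x m \<omega>) n (shift m \<omega>)"
  by (induction n) (auto simp: shift_def)

lemma cocycle_add: "cocycle (m + n) \<omega> = cocycle n (shift m \<omega>) ** cocycle m \<omega>"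
  by (induction n) (auto simp: shift_def matrix_mul_assoc)

text \<open>The translation parts cancel. Both the exit argument and the block recursion of the
  lower bound compare orbits through this identity.\<close>

lemma orbit_diff: "orbit x n \<omega> - orbit y n \<omega> = cocycle n \<omega> *v (x - y)"
proof (induction n)
  case (Suc n)
  have "orbit x (Suc n) \<omega> - orbit y (Suc n) \<omega> = fst (\<omega> n) *v (orbit x n \<omega> - orbit y n \<omega>)"
    by (simp add: matrix_vector_mult_diff_distrib)
  also have "\<dots> = cocycle (Suc n) \<omega> *v (x - y)"
    unfolding Suc by (simp add: matrix_vector_mul_assoc)
  finally show ?case .
qed simp

text \<open>On the infinite product of one law, the shift preserves the measure, and
  \<open>comb_seq m\<close> glues the first \<open>m\<close> coordinates of one environment to
  another, independent one. Independence then becomes a Fubini argument.\<close>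

locale iid_affine = sequence_space \<mu> for \<mu> :: "'n::finite affine_map measure" +
  assumes sets_\<mu> [measurable_cong]: "sets \<mu> = sets borel"
begin

sublocale \<mu>: prob_space \<mu>
  by (rule M.prob_space_axioms)

lemma measurable_coordinate [measurable]:
  "(\<lambda>\<omega>. \<omega> n) \<in> S \<rightarrow>\<^sub>M \<mu>"
  by (rule measurable_component_singleton) simp

lemma measurable_matrix_part [measurable]: "(\<lambda>\<omega>. fst (\<omega> n)) \<in> borel_measurable S"
proof -
  have "fst \<in> borel_measurable (borel :: 'n affine_map measure)"
    by (intro borel_measurable_continuous_onI continuous_intros)
  then have "fst \<in> borel_measurable \<mu>"
    using sets_\<mu> by (simp add: measurable_def sets_eq_imp_space_eq cong: measurable_cong_sets)
  then show ?thesis by measurable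
qed

lemma measurable_vector_part [measurable]: "(\<lambda>\<omega>. snd (\<omega> n)) \<in> borel_measurable S"
proof -
  have "snd \<in> borel_measurable (borel :: 'n affine_map measure)"
    by (intro borel_measurable_continuous_onI continuous_intros)
  then have "snd \<in> borel_measurable \<mu>"
    using sets_\<mu> by (simp add: measurable_def sets_eq_imp_space_eq cong: measurable_cong_sets)
  then show ?thesis by measurable
qed

lemma measurable_orbit [measurable]: "orbit x n \<in> borel_measurable S"
proof (induction n)
  case (Suc n)
  have "(\<lambda>\<omega>. fst (\<omega> n) *v orbit x n \<omega> + snd (\<omega> n)) \<in> borel_measurable S"
    using Suc by measurable
  then show ?case by (simp cong: measurable_cong)
qed simp

lemma measurable_cocycle [measurable]: "cocycle n \<in> borel_measurable S"
proof (induction n)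
  case (Suc n)
  have "(\<lambda>\<omega>. fst (\<omega> n) ** cocycle n \<omega>) \<in> borel_measurable S"
    using Suc by measurable
  then show ?case by (simp cong: measurable_cong)
qed simp

lemma measurable_shift [measurable]: "shift m \<in> S \<rightarrow>\<^sub>M S"
  unfolding shift_def[abs_def] by (rule measurable_PiM_single') (auto simp: space_PiM PiE_iff)

lemma measurable_cocycle_growth:
  "Measurable.pred S (\<lambda>\<omega>. \<forall>\<^sub>F n in sequentially. exp (b * real n) \<le> norm (cocycle n \<omega>))"
  "Measurable.pred S (\<lambda>\<omega>. \<forall>\<^sub>F n in sequentially. norm (cocycle n \<omega>) \<le> exp (b * real n))"
  unfolding eventually_sequentially by measurable

text \<open>\<open>S\<close> is the image of two independent copies of itself under
  \<open>comb_seq m\<close>, so an almost sure statement can be conditioned on the first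
  \<open>m\<close> steps.\<close>

lemma AE_S_iff_AE_comb_seq:
  assumes [measurable]: "Measurable.pred S P"
  shows "(AE \<omega> in S. P \<omega>) \<longleftrightarrow> (AE \<omega> in S. AE \<omega>' in S. P (comb_seq m \<omega> \<omega>'))"
proof -
  interpret SS: pair_prob_space S S ..
  have "(AE \<omega> in S. P \<omega>) \<longleftrightarrow> (AE z in S \<Otimes>\<^sub>M S. P (case z of (\<omega>, \<omega>') \<Rightarrow> comb_seq m \<omega> \<omega>'))"
    by (subst PiM_comb_seq[of m, symmetric], subst AE_distr_iff[OF measurable_comb_seq])
       (auto intro: predE)
  also have "\<dots> \<longleftrightarrow> (AE \<omega> in S. AE \<omega>' in S. P (comb_seq m \<omega> \<omega>'))"
  proof -
    have "Measurable.pred (S \<Otimes>\<^sub>M S) (\<lambda>z. P (case z of (\<omega>, \<omega>') \<Rightarrow> comb_seq m \<omega> \<omega>'))"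
      by measurable
    from SS.AE_pair_iff[of "\<lambda>\<omega> \<omega>'. P (comb_seq m \<omega> \<omega>')"] predE[OF this] show ?thesis
      by (simp add: split_beta)
  qed
  finally show ?thesis .
qed

text \<open>The same splitting for bounded functions. The unprimed forms fix the past and integrate
  over the future; the primed forms fix the future, which is what is wanted when the late factors of
  a product are held fixed.\<close>

lemma
  fixes f :: "(nat \<Rightarrow> 'n affine_map) \<Rightarrow> real"
  assumes f [measurable]: "f \<in> borel_measurable S" and bnd: "\<And>\<omega>. \<bar>f \<omega>\<bar> \<le> K"
  shows expectation_comb_seq: "(\<integral>\<omega>. f \<omega> \<partial>S) = (\<integral>\<omega>. \<integral>\<omega>'. f (comb_seq m \<omega> \<omega>') \<partial>S \<partial>S)"
    and integrable_comb_seq: "integrable S (\<lambda>\<omega>. \<integral>\<omega>'. f (comb_seq m \<omega> \<omega>') \<partial>S)"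
    and integrable_comb_seq': "integrable S (\<lambda>\<omega>'. \<integral>\<omega>. f (comb_seq m \<omega> \<omega>') \<partial>S)"
    and expectation_comb_seq': "(\<integral>\<omega>. f \<omega> \<partial>S) = (\<integral>\<omega>'. \<integral>\<omega>. f (comb_seq m \<omega> \<omega>') \<partial>S \<partial>S)"
proof -
  interpret SS: pair_prob_space S S ..
  have int: "integrable (S \<Otimes>\<^sub>M S) (\<lambda>(\<omega>, \<omega>'). f (comb_seq m \<omega> \<omega>'))"
    by (rule SS.integrable_const_bound[of _ K]) (auto simp: bnd)
  have eq: "(\<integral>\<omega>. f \<omega> \<partial>S) = (\<integral>z. (case z of (\<omega>, \<omega>') \<Rightarrow> f (comb_seq m \<omega> \<omega>')) \<partial>(S \<Otimes>\<^sub>M S))"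
    by (subst PiM_comb_seq[of m, symmetric], subst integral_distr[OF measurable_comb_seq f])
       (simp add: case_prod_beta')
  show "(\<integral>\<omega>. f \<omega> \<partial>S) = (\<integral>\<omega>. \<integral>\<omega>'. f (comb_seq m \<omega> \<omega>') \<partial>S \<partial>S)"
    unfolding eq by (subst SS.integral_fst[OF int]) simp
  show "integrable S (\<lambda>\<omega>. \<integral>\<omega>'. f (comb_seq m \<omega> \<omega>') \<partial>S)"
    using SS.integrable_fst[OF int] by simp
  show "integrable S (\<lambda>\<omega>'. \<integral>\<omega>. f (comb_seq m \<omega> \<omega>') \<partial>S)"
    using SS.integrable_snd[OF int] by simp
  show "(\<integral>\<omega>. f \<omega> \<partial>S) = (\<integral>\<omega>'. \<integral>\<omega>. f (comb_seq m \<omega> \<omega>') \<partial>S \<partial>S)"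
    unfolding eq by (subst SS.integral_snd[OF int]) simp
qed

text \<open>After writing \<open>S\<close> as the image of a product under
  \<open>comb_seq m\<close>, the shift is the second projection.\<close>

lemma distr_shift: "distr S S (shift m) = S"
proof -
  have "distr S S (shift m) = distr (distr (S \<Otimes>\<^sub>M S) S (\<lambda>(\<omega>, \<omega>'). comb_seq m \<omega> \<omega>')) S (shift m)"
    by (simp add: PiM_comb_seq)
  also have "\<dots> = distr (S \<Otimes>\<^sub>M S) S snd"
    by (subst distr_distr[OF _ measurable_comb_seq])
       (auto simp: comp_def split_beta intro!: distr_cong)
  also have "\<dots> = S"
  proof (rule measure_eqI)
    fix X assume "X \<in> sets (distr (S \<Otimes>\<^sub>M S) S snd)"
    then have X: "X \<in> sets S" by simp
    then have "snd -` X \<inter> space (S \<Otimes>\<^sub>M S) = space S \<times> X"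
      by (auto simp: space_pair_measure dest: sets.sets_into_space)
    then show "emeasure (distr (S \<Otimes>\<^sub>M S) S snd) X = emeasure S X"
      using X by (simp add: emeasure_distr P.emeasure_pair_measure_Times P.emeasure_space_1)
  qed simp
  finally show ?thesis .
qed

lemma prob_shift:
  assumes [measurable]: "Measurable.pred S P"
  shows "\<P>(\<omega> in S. P (shift m \<omega>)) = \<P>(\<omega> in S. P \<omega>)"
proof -
  have "\<P>(\<omega> in S. P \<omega>) = measure (distr S S (shift m)) {\<omega> \<in> space S. P \<omega>}"
    by (simp add: distr_shift)
  also have "\<dots> = measure S (shift m -` {\<omega> \<in> space S. P \<omega>} \<inter> space S)"
    by (rule measure_distr) auto
  also have "shift m -` {\<omega> \<in> space S. P \<omega>} \<inter> space S = {\<omega> \<in> space S. P (shift m \<omega>)}"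
    using measurable_space[OF measurable_shift[of m]] by auto
  finally show ?thesis by simp
qed

end

section \<open>Limits in probability and truncated norms\<close>

lemma filterlim_exp_mult_real:
  "0 < c \<Longrightarrow> filterlim (\<lambda>n. exp (c * real n)) at_top sequentially"
  by (intro filterlim_compose[OF exp_at_top] filterlim_real_sequentially
      filterlim_tendsto_pos_mult_at_top[OF tendsto_const])

text \<open>Dominated convergence for indicators. This is how almost sure growth rates become
  probabilities at a fixed time.\<close>

lemma (in prob_space) prob_tendsto_1_if_AE_eventually:
  assumes [measurable]: "\<And>n. Measurable.pred M (P n)"
    and AE: "AE \<omega> in M. \<forall>\<^sub>F n in sequentially. P n \<omega>"
  shows "(\<lambda>n. prob {\<omega> \<in> space M. P n \<omega>}) \<longlonglongrightarrow> 1"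
proof -
  have "(\<lambda>n. \<integral>\<omega>. indicator {\<omega> \<in> space M. P n \<omega>} \<omega> \<partial>M) \<longlonglongrightarrow> (\<integral>\<omega>. (1::real) \<partial>M)"
  proof (rule integral_dominated_convergence[where w = "\<lambda>_. 1"])
    show "AE \<omega> in M. (\<lambda>n. indicator {\<omega> \<in> space M. P n \<omega>} \<omega> :: real) \<longlonglongrightarrow> 1"
      using AE AE_space
    proof eventually_elim
      case (elim \<omega>)
      then have "\<forall>\<^sub>F n in sequentially. 1 = (indicator {\<omega> \<in> space M. P n \<omega>} \<omega> :: real)"
        by (auto elim: eventually_mono)
      then show ?case by (rule Lim_transform_eventually[OF tendsto_const])
    qed
  qed (auto simp: indicator_def)
  then show ?thesis by (simp add: prob_space)
qed

text \<open>The truncation at 1 supplies the dominating function, so pointwise continuity in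
  \<open>p\<close> is enough and no moment of \<open>F p\<close> enters.\<close>

lemma (in prob_space) continuous_on_expectation_min_1_norm:
  fixes F :: "'b::metric_space \<Rightarrow> 'a \<Rightarrow> 'c::{real_normed_vector, second_countable_topology}"
  assumes [measurable]: "\<And>p. F p \<in> borel_measurable M"
    and cont: "\<And>\<omega>. continuous_on UNIV (\<lambda>p. F p \<omega>)"
  shows "continuous_on X (\<lambda>p. \<integral>\<omega>. min 1 (norm (F p \<omega>)) \<partial>M)"
proof (rule continuous_on_sequentiallyI)
  fix u :: "nat \<Rightarrow> 'b" and a assume u: "u \<longlonglongrightarrow> a"
  show "(\<lambda>n. \<integral>\<omega>. min 1 (norm (F (u n) \<omega>)) \<partial>M) \<longlonglongrightarrow> (\<integral>\<omega>. min 1 (norm (F a \<omega>)) \<partial>M)"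
  proof (rule integral_dominated_convergence[where w = "\<lambda>_. 1"])
    have "(\<lambda>n. F (u n) \<omega>) \<longlonglongrightarrow> F a \<omega>" for \<omega>
      using cont[of \<omega>] u by (auto simp: continuous_on_sequentially comp_def)
    then show "AE \<omega> in M. (\<lambda>n. min 1 (norm (F (u n) \<omega>))) \<longlonglongrightarrow> min 1 (norm (F a \<omega>))"
      by (intro AE_I2 tendsto_intros)
  qed auto
qed

lemma (in prob_space) integrable_min_1_norm [simp]:
  assumes [measurable]: "(f :: 'a \<Rightarrow> 'c::{real_normed_vector, second_countable_topology}) \<in> borel_measurable M"
  shows "integrable M (\<lambda>\<omega>. min 1 (norm (f \<omega>)))"
  by (rule integrable_const_bound[of _ 1]) auto

lemma (in prob_space) expectation_min_1_norm_pos: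
  assumes [measurable]: "(f :: 'a \<Rightarrow> 'c::{real_normed_vector, second_countable_topology}) \<in> borel_measurable M"
    and "\<not> (AE \<omega> in M. f \<omega> = 0)"
  shows "0 < (\<integral>\<omega>. min 1 (norm (f \<omega>)) \<partial>M)"
proof -
  have "(\<integral>\<omega>. min 1 (norm (f \<omega>)) \<partial>M) = 0 \<longleftrightarrow> (AE \<omega> in M. min 1 (norm (f \<omega>)) = 0)"
    by (rule integral_nonneg_eq_0_iff_AE) auto
  moreover have "min 1 (norm (f \<omega>)) = 0 \<longleftrightarrow> f \<omega> = 0" for \<omega>
    by (auto simp: min_def)
  ultimately have "(\<integral>\<omega>. min 1 (norm (f \<omega>)) \<partial>M) \<noteq> 0"
    using assms(2) by simp
  moreover have "0 \<le> (\<integral>\<omega>. min 1 (norm (f \<omega>)) \<partial>M)"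
    by (rule integral_nonneg_AE) auto
  ultimately show ?thesis by linarith
qed

lemma min_1_mult_ge: "0 \<le> a \<Longrightarrow> 0 \<le> b \<Longrightarrow> min 1 a * min 1 b \<le> min 1 (a * b)" for a b :: real
proof -
  assume "0 \<le> a" "0 \<le> b"
  then have "min 1 a * min 1 b \<le> 1 * 1" "min 1 a * min 1 b \<le> a * b"
    by (intro mult_mono; simp)+
  then show ?thesis by simp
qed

section \<open>Uniform expansion of directions and uniform displacement\<close>

text \<open>Here \<open>c\<close> is any positive real rate below the Lyapunov exponent, so the case
  of an infinite exponent is covered as well. Condition (c) of the theorem enters as
  \<open>no_fixed_point\<close>.\<close>

locale expanding_affine = iid_affine \<mu> for \<mu> :: "'n::finite affine_map measure" +
  fixes c :: real
  assumes c_pos: "0 < c"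
    and growth: "AE \<omega> in S. \<forall>\<^sub>F n in sequentially. exp (c * real n) \<le> norm (cocycle n \<omega>)"
    and irreducible: "subspace V \<Longrightarrow> AE \<omega> in S. (*v) (fst (\<omega> 0)) ` V \<subseteq> V \<Longrightarrow> V = {0} \<or> V = UNIV"
    and no_fixed_point: "\<not> (AE \<omega> in S. fst (\<omega> 0) *v x + snd (\<omega> 0) = x)"
begin

text \<open>The vectors that \<open>G\<close> almost surely annihilates after any number of steps
  form a subspace \<open>L\<close>. Conditioning on the first step shows that the random matrix maps
  \<open>L\<close> into itself almost surely. Irreducibility and the presence of a nonzero vector
  make \<open>L\<close> the whole space, and then zero steps give \<open>G = 0\<close>.\<close>

lemma cocycle_nonvanishing:
  assumes "G \<noteq> (0 :: real^'n^'n)" "v \<noteq> 0"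
  shows "\<exists>m. \<not> (AE \<omega> in S. G *v (cocycle m \<omega> *v v) = 0)"
proof (rule ccontr)
  assume "\<not> ?thesis"
  then have v: "AE \<omega> in S. G *v (cocycle m \<omega> *v v) = 0" for m by blast
  define L where "L = {w. \<forall>m. AE \<omega> in S. G *v (cocycle m \<omega> *v w) = 0}"
  have lin: "linear (\<lambda>w. G *v (cocycle m \<omega> *v w))" for m \<omega>
    by (intro linear_compose[unfolded comp_def, of "(*v) (cocycle m \<omega>)" "(*v) G"] matrix_vector_mul_linear)
  have sub: "subspace L"
  proof (rule subspaceI)
    show "0 \<in> L" by (simp add: L_def)
    fix x y assume xy: "x \<in> L" "y \<in> L"
    have "AE \<omega> in S. G *v (cocycle m \<omega> *v (x + y)) = 0" for m
    proof -
      from xy have "AE \<omega> in S. G *v (cocycle m \<omega> *v x) = 0"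
        "AE \<omega> in S. G *v (cocycle m \<omega> *v y) = 0" by (simp_all add: L_def)
      then show ?thesis by eventually_elim (simp add: linear_add[OF lin])
    qed
    then show "x + y \<in> L"
      by (simp add: L_def)
  next
    fix a x assume "x \<in> L"
    then show "a *\<^sub>R x \<in> L"
      unfolding L_def by (auto simp: linear_scale[OF lin])
  qed
  have inv1: "AE \<omega> in S. fst (\<omega> 0) *v w \<in> L" if w: "w \<in> L" for w
  proof -
    have "AE \<omega> in S. AE \<omega>' in S. G *v (cocycle m \<omega>' *v (fst (\<omega> 0) *v w)) = 0" for m
    proof -
      have "AE \<omega> in S. G *v (cocycle (1 + m) \<omega> *v w) = 0"
        using w unfolding L_def by blast
      then have "AE \<omega> in S. AE \<omega>' in S. G *v (cocycle (1 + m) (comb_seq 1 \<omega> \<omega>') *v w) = 0"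
        by (subst (asm) AE_S_iff_AE_comb_seq[where m = 1]) measurable
      then show ?thesis
        unfolding cocycle_add by (simp add: matrix_vector_mul_assoc matrix_mul_assoc comb_seq_less del: comb_seq_Suc_0)
    qed
    then show ?thesis
      unfolding L_def mem_Collect_eq by (subst AE_all_countable) blast
  qed
  \<comment> \<open>The exceptional null set in \<open>inv1\<close> depends on the vector; a finite
    spanning set leaves only finitely many of them.\<close>
  obtain T where T: "T \<subseteq> L" "finite T" "L \<subseteq> span T"
    using basis_exists[of L] finiteI_independent by metis
  have "AE \<omega> in S. (*v) (fst (\<omega> 0)) ` L \<subseteq> L"
  proof -
    have "AE \<omega> in S. \<forall>b\<in>T. fst (\<omega> 0) *v b \<in> L"
      using T inv1 by (subst AE_ball_countable) (auto intro: countable_finite)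
    then show ?thesis
    proof eventually_elim
      case (elim \<omega>)
      have "(*v) (fst (\<omega> 0)) ` span T = span ((*v) (fst (\<omega> 0)) ` T)"
        by (rule linear_span_image[symmetric]) (rule matrix_vector_mul_linear)
      also have "\<dots> \<subseteq> L"
        using elim sub by (intro span_minimal) auto
      finally show ?case using T by blast
    qed
  qed
  from irreducible[OF sub this] have "L = UNIV"
    using v \<open>v \<noteq> 0\<close> by (auto simp: L_def)
  then have "AE \<omega> in S. G *v (cocycle 0 \<omega> *v w) = 0" for w
    unfolding L_def by blast
  then have "G *v w = 0" for w
    by (simp add: P.AE_const)
  then have "G = 0"
    by (metis matrix_eq matrix_vector_mult_0)
  then show False using \<open>G \<noteq> 0\<close> by simp
qed

text \<open>How many steps are required depends on \<open>G\<close> and \<open>v\<close>. By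
  continuity a choice that works at one pair works nearby, so finitely many \<open>m\<close> cover
  the compact product of the unit spheres, and summing over \<open>m\<close> avoids choosing among
  them. Scaling back to arbitrary \<open>G\<close> and \<open>v\<close> costs the factor
  \<open>min 1 (norm G * norm v)\<close>, by \<open>min_1_mult_ge\<close>.\<close>

lemma expectation_cocycle_ge:
  obtains m\<^sub>0 \<eta> where "\<eta> > 0"
    "\<And>(G :: real^'n^'n) v. \<eta> * min 1 (norm G * norm v)
       \<le> (\<Sum>m\<le>m\<^sub>0. \<integral>\<omega>. min 1 (norm (G *v (cocycle m \<omega> *v v))) \<partial>S)"
proof -
  define f where "f m p = (\<integral>\<omega>. min 1 (norm (fst p *v (cocycle m \<omega> *v snd p))) \<partial>S)"
    for m and p :: "(real^'n^'n) \<times> (real^'n)"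
  define K where "K = sphere (0 :: real^'n^'n) 1 \<times> sphere (0 :: real^'n) 1"
  have cont: "continuous_on X (f m)" for m X
    unfolding f_def[abs_def]
    by (rule P.continuous_on_expectation_min_1_norm) (auto intro!: continuous_intros)
  have f_nonneg: "0 \<le> f m p" for m p
    unfolding f_def by (rule integral_nonneg_AE) auto
  have "compact K"
    unfolding K_def by (intro compact_Times compact_sphere)
  have "\<exists>m. 0 < f m p" if "p \<in> K" for p
  proof -
    have "fst p \<noteq> 0" "snd p \<noteq> 0" using that by (auto simp: K_def)
    from cocycle_nonvanishing[OF this] obtain m where
      "\<not> (AE \<omega> in S. fst p *v (cocycle m \<omega> *v snd p) = 0)" ..
    from P.expectation_min_1_norm_pos[OF _ this] show ?thesis
      unfolding f_def by auto
  qed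
  then have "K \<subseteq> (\<Union>m\<in>UNIV. {p. 0 < f m p})" by auto
  moreover have "open {p. 0 < f m p}" for m
    by (intro open_Collect_less cont continuous_on_const)
  ultimately obtain C where C: "finite C" "K \<subseteq> (\<Union>m\<in>C. {p. 0 < f m p})"
    using compactE_image[OF \<open>compact K\<close>, of UNIV "\<lambda>m. {p. 0 < f m p}"] by metis
  then obtain m\<^sub>0 where m0: "C \<subseteq> {..m\<^sub>0}"
    by (meson finite_nat_iff_bounded_le)
  define F where "F p = (\<Sum>m\<le>m\<^sub>0. f m p)" for p
  have Fpos: "0 < F p" if p: "p \<in> K" for p
  proof -
    obtain m where "m \<in> C" "0 < f m p" using C p by blast
    then show ?thesis
      unfolding F_def using m0 by (intro sum_pos2[of _ m]) (auto simp: f_nonneg)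
  qed
  have "\<exists>\<eta>>0. \<forall>p\<in>K. \<eta> \<le> F p"
  proof (cases "K = {}")
    case False
    have "continuous_on K F"
      unfolding F_def[abs_def] by (intro continuous_on_sum cont)
    from continuous_attains_inf[OF \<open>compact K\<close> False this] obtain q
      where "q \<in> K" "\<forall>p\<in>K. F q \<le> F p" by blast
    then show ?thesis using Fpos by blast
  qed (auto intro: zero_less_one)
  then obtain \<eta> where \<eta>: "\<eta> > 0" "\<And>p. p \<in> K \<Longrightarrow> \<eta> \<le> F p" by blast
  show thesis
  proof (rule that[of \<eta> m\<^sub>0])
    fix G :: "real^'n^'n" and v :: "real^'n"
    show "\<eta> * min 1 (norm G * norm v)
       \<le> (\<Sum>m\<le>m\<^sub>0. \<integral>\<omega>. min 1 (norm (G *v (cocycle m \<omega> *v v))) \<partial>S)"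
    proof (cases "G = 0 \<or> v = 0")
      case True
      then show ?thesis by (auto intro!: sum_nonneg integral_nonneg_AE)
    next
      case False
      define G' v' where "G' = G /\<^sub>R norm G" and "v' = v /\<^sub>R norm v"
      have "(G', v') \<in> K" using False by (auto simp: K_def G'_def v'_def)
      then have "\<eta> * min 1 (norm G * norm v) \<le> F (G', v') * min 1 (norm G * norm v)"
        by (intro mult_right_mono \<eta>) auto
      also have "\<dots> = (\<Sum>m\<le>m\<^sub>0. min 1 (norm G * norm v) * f m (G', v'))"
        by (simp add: F_def sum_distrib_left mult.commute)
      also have "\<dots> \<le> (\<Sum>m\<le>m\<^sub>0. \<integral>\<omega>. min 1 (norm (G *v (cocycle m \<omega> *v v))) \<partial>S)"
      proof (rule sum_mono)
        fix m
        have G: "G = norm G *\<^sub>R G'" and v: "v = norm v *\<^sub>R v'"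
          using False by (auto simp: G'_def v'_def)
        have eq: "norm (G *v (cocycle m \<omega> *v v)) = (norm G * norm v) * norm (G' *v (cocycle m \<omega> *v v'))" for \<omega>
          by (subst G, subst v)
             (simp add: scaleR_matrix_vector_assoc[symmetric] linear_scale[OF matrix_vector_mul_linear])
        have "min 1 (norm G * norm v) * f m (G', v')
            = (\<integral>\<omega>. min 1 (norm G * norm v) * min 1 (norm (G' *v (cocycle m \<omega> *v v'))) \<partial>S)"
          by (simp add: f_def)
        also have "\<dots> \<le> (\<integral>\<omega>. min 1 (norm (G *v (cocycle m \<omega> *v v))) \<partial>S)"
        proof (rule integral_mono)
          show "min 1 (norm G * norm v) * min 1 (norm (G' *v (cocycle m \<omega> *v v')))
            \<le> min 1 (norm (G *v (cocycle m \<omega> *v v)))" for \<omega>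
            unfolding eq by (rule min_1_mult_ge) auto
        qed simp_all
        finally show "min 1 (norm G * norm v) * f m (G', v')
          \<le> (\<integral>\<omega>. min 1 (norm (G *v (cocycle m \<omega> *v v))) \<partial>S)" .
      qed
      finally show ?thesis .
    qed
  qed fact
qed

text \<open>A product of large norm may still contract the particular direction of \<open>v\<close>.
  The first \<open>m\<close> steps turn \<open>v\<close> away from such directions, and the
  following \<open>N\<close> steps then expand: their rescaled product has norm at least 1 with
  probability above 1/2, which is where the constant is halved.\<close>

lemma expectation_rescaled_cocycle_ge:
  obtains N\<^sub>0 m\<^sub>0 \<eta> where "\<eta> > 0"
    "\<And>N v. N\<^sub>0 \<le> N \<Longrightarrow> \<eta> * min 1 (norm v)
       \<le> (\<Sum>m\<le>m\<^sub>0. \<integral>\<omega>. min 1 (exp (- c * real N) * norm (cocycle (m + N) \<omega> *v v)) \<partial>S)"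
proof -
  obtain m\<^sub>0 \<eta> where \<eta>: "\<eta> > 0" "\<And>(G :: real^'n^'n) v. \<eta> * min 1 (norm G * norm v)
       \<le> (\<Sum>m\<le>m\<^sub>0. \<integral>\<omega>. min 1 (norm (G *v (cocycle m \<omega> *v v))) \<partial>S)"
    by (rule expectation_cocycle_ge) blast
  let ?p = "\<lambda>N. P.prob {\<omega> \<in> space S. exp (c * real N) \<le> norm (cocycle N \<omega>)}"
  have "?p \<longlonglongrightarrow> 1"
    by (rule P.prob_tendsto_1_if_AE_eventually[OF _ growth]) measurable
  then have "\<forall>\<^sub>F N in sequentially. 1/2 < ?p N"
    by (rule order_tendstoD) simp
  then obtain N\<^sub>0 where N0: "\<And>N. N\<^sub>0 \<le> N \<Longrightarrow> 1/2 < ?p N"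
    by (auto simp: eventually_sequentially)
  show thesis
  proof (rule that[of "\<eta> / 2" N\<^sub>0 m\<^sub>0])
    fix N and v :: "real^'n" assume "N\<^sub>0 \<le> N"
    define G where "G \<omega> = exp (- c * real N) *\<^sub>R cocycle N \<omega>" for \<omega> :: "nat \<Rightarrow> 'n affine_map"
    define g where "g m \<omega> = min 1 (exp (- c * real N) * norm (cocycle (m + N) \<omega> *v v))"
      for m and \<omega> :: "nat \<Rightarrow> 'n affine_map"
    have [measurable]: "g m \<in> borel_measurable S" for m
      unfolding g_def[abs_def] by measurable
    have bnd: "\<bar>g m \<omega>\<bar> \<le> 1" for m \<omega> by (auto simp: g_def)
    \<comment> \<open>The last \<open>N\<close> factors are read from \<omega>' and the first
      \<open>m\<close> from \<omega>, so the previous bound applies with \<open>G \<omega>'\<close>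
      held fixed.\<close>
    have g: "g m (comb_seq m \<omega> \<omega>') = min 1 (norm (G \<omega>' *v (cocycle m \<omega> *v v)))" for m \<omega> \<omega>'
      unfolding g_def cocycle_add
      by (simp add: G_def scaleR_matrix_vector_assoc[symmetric] matrix_vector_mul_assoc[symmetric])
    have int: "integrable S (\<lambda>\<omega>'. \<integral>\<omega>. g m (comb_seq m \<omega> \<omega>') \<partial>S)" for m
      by (rule integrable_comb_seq'[OF _ bnd]) measurable
    have ind: "integrable S (indicator {\<omega> \<in> space S. exp (c * real N) \<le> norm (cocycle N \<omega>)} :: _ \<Rightarrow> real)"
      by (intro integrable_real_indicator) (auto simp: P.emeasure_eq_measure)
    have "(\<eta> / 2) * min 1 (norm v) \<le> (\<eta> * min 1 (norm v)) * ?p N"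
    proof -
      have "(\<eta> * min 1 (norm v)) * (1/2) \<le> (\<eta> * min 1 (norm v)) * ?p N"
        using N0[OF \<open>N\<^sub>0 \<le> N\<close>] \<open>\<eta> > 0\<close> by (intro mult_left_mono) auto
      then show ?thesis by simp
    qed
    also have "\<dots> = (\<integral>\<omega>'. (\<eta> * min 1 (norm v)) *
        indicator {\<omega> \<in> space S. exp (c * real N) \<le> norm (cocycle N \<omega>)} \<omega>' \<partial>S)"
      by simp
    also have "\<dots> \<le> (\<integral>\<omega>'. (\<Sum>m\<le>m\<^sub>0. \<integral>\<omega>. g m (comb_seq m \<omega> \<omega>') \<partial>S) \<partial>S)"
    proof (rule integral_mono)
      fix \<omega>'
      have "\<eta> * min 1 (norm v) * indicator {\<omega> \<in> space S. exp (c * real N) \<le> norm (cocycle N \<omega>)} \<omega>'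
          \<le> \<eta> * min 1 (norm (G \<omega>') * norm v)"
      proof (cases "exp (c * real N) \<le> norm (cocycle N \<omega>')")
        case True
        have "1 = exp (- c * real N) * exp (c * real N)"
          by (simp add: exp_minus)
        also have "\<dots> \<le> norm (G \<omega>')"
          using True by (auto simp: G_def intro: mult_left_mono)
        finally have "norm v \<le> norm (G \<omega>') * norm v"
          by (metis mult_right_mono mult_1 norm_ge_zero)
        then show ?thesis
          using \<open>\<eta> > 0\<close> by (auto simp: indicator_def intro!: mult_left_mono min.mono)
      qed (use \<open>\<eta> > 0\<close> in auto)
      also have "\<dots> \<le> (\<Sum>m\<le>m\<^sub>0. \<integral>\<omega>. g m (comb_seq m \<omega> \<omega>') \<partial>S)"
        unfolding g by (rule \<eta>)
      finally show "\<eta> * min 1 (norm v) * indicator {\<omega> \<in> space S. exp (c * real N) \<le> norm (cocycle N \<omega>)} \<omega>'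
          \<le> (\<Sum>m\<le>m\<^sub>0. \<integral>\<omega>. g m (comb_seq m \<omega> \<omega>') \<partial>S)" .
    qed (auto intro!: Bochner_Integration.integrable_sum int ind)
    also have "\<dots> = (\<Sum>m\<le>m\<^sub>0. \<integral>\<omega>. g m \<omega> \<partial>S)"
      by (subst Bochner_Integration.integral_sum[OF int])
         (intro sum.cong refl expectation_comb_seq'[OF _ bnd, symmetric], measurable)
    finally show "(\<eta> / 2) * min 1 (norm v)
       \<le> (\<Sum>m\<le>m\<^sub>0. \<integral>\<omega>. min 1 (exp (- c * real N) * norm (cocycle (m + N) \<omega> *v v)) \<partial>S)"
      unfolding g_def .
  qed (use \<eta> in auto)
qed

text \<open>A fixed nonzero vector spans an invariant line, which by irreducibility is the whole
  space. Then every matrix of the environment is almost surely the identity, against exponential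
  growth.\<close>

lemma no_fixed_vector:
  assumes "v \<noteq> 0"
  shows "\<not> (AE \<omega> in S. fst (\<omega> 0) *v v = v)"
proof
  assume fixed: "AE \<omega> in S. fst (\<omega> 0) *v v = v"
  then have fixed_span: "AE \<omega> in S. \<forall>w\<in>span {v}. fst (\<omega> 0) *v w = w"
    by eventually_elim (auto simp: span_singleton linear_scale[OF matrix_vector_mul_linear])
  then have "AE \<omega> in S. (*v) (fst (\<omega> 0)) ` span {v} \<subseteq> span {v}"
    by eventually_elim auto
  from irreducible[OF subspace_span this] have "span {v} = UNIV"
    using \<open>v \<noteq> 0\<close> span_base[of v "{v}"] by auto
  with fixed_span have "AE \<omega> in S. fst (\<omega> 0) = mat 1"
    by (auto simp: matrix_eq)
  then have "AE \<omega> in distr S S (shift i). fst (\<omega> 0) = mat 1" for i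
    unfolding distr_shift .
  then have "AE \<omega> in S. fst (shift i \<omega> 0) = mat 1" for i
    by (rule AE_distrD[OF measurable_shift])
  then have "AE \<omega> in S. \<forall>i. fst (\<omega> i) = mat 1"
    by (simp add: AE_all_countable shift_def)
  with growth have "AE \<omega> in S. False"
  proof eventually_elim
    case (elim \<omega>)
    have "cocycle n \<omega> = mat 1" for n
      by (induction n) (use elim in auto)
    have "filterlim (\<lambda>n. exp (c * real n)) at_top sequentially"
      by (rule filterlim_exp_mult_real[OF c_pos])
    then have "\<forall>\<^sub>F n in sequentially. norm (mat 1 :: real^'n^'n) < exp (c * real n)"
      by (auto simp: filterlim_at_top_dense)
    with elim(1) have "\<forall>\<^sub>F n in sequentially. False"
      by eventually_elim (simp add: \<open>\<And>n. cocycle n \<omega> = mat 1\<close>)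
    then show ?case by simp
  qed
  then show False by (simp add: P.AE_const)
qed

text \<open>The starting points are not compact, so the displacement is homogenised:
  \<open>F (s, y)\<close> is \<open>s\<close> times the displacement at \<open>y / s\<close>, and
  \<open>s = 0\<close> represents the directions at infinity. On the unit sphere it is never almost
  surely zero, by \<open>no_fixed_point\<close> for nonzero \<open>s\<close> and by
  \<open>no_fixed_vector\<close> for \<open>s = 0\<close>.\<close>

lemma expectation_displacement_ge:
  obtains \<epsilon> where "\<epsilon> > 0"
    "\<And>x. \<epsilon> \<le> (\<integral>\<omega>. min 1 (norm (fst (\<omega> 0) *v x + snd (\<omega> 0) - x)) \<partial>S)"
proof -
  define F where "F p \<omega> = fst (\<omega> 0) *v snd p + fst p *\<^sub>R snd (\<omega> 0) - snd p"
    for p :: "real \<times> (real^'n)" and \<omega> :: "nat \<Rightarrow> 'n affine_map"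
  define f where "f p = (\<integral>\<omega>. min 1 (norm (F p \<omega>)) \<partial>S)" for p
  let ?K = "sphere (0 :: real \<times> (real^'n)) 1"
  have [measurable]: "F p \<in> borel_measurable S" for p
    unfolding F_def[abs_def] by measurable
  have cont: "continuous_on X f" for X
    unfolding f_def[abs_def]
    by (rule P.continuous_on_expectation_min_1_norm, measurable)
       (auto intro!: continuous_intros simp: F_def)
  have pos: "0 < f p" if "p \<in> ?K" for p
    unfolding f_def
  proof (rule P.expectation_min_1_norm_pos)
    show "\<not> (AE \<omega> in S. F p \<omega> = 0)"
    proof (cases "fst p = 0")
      case True
      then have "snd p \<noteq> 0" using that by (auto simp: norm_prod_def)
      then show ?thesis using no_fixed_vector[of "snd p"] True by (simp add: F_def)
    next
      case False
      have "fst (\<omega> 0) *v (snd p /\<^sub>R fst p) + snd (\<omega> 0) - snd p /\<^sub>R fst p = F p \<omega> /\<^sub>R fst p" for \<omega>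
        using False
        by (simp add: F_def linear_scale[OF matrix_vector_mul_linear] scaleR_add_right scaleR_diff_right)
      then have "F p \<omega> = 0 \<longleftrightarrow> fst (\<omega> 0) *v (snd p /\<^sub>R fst p) + snd (\<omega> 0) = snd p /\<^sub>R fst p" for \<omega>
        using False by (metis eq_iff_diff_eq_0 scaleR_eq_0_iff inverse_nonzero_iff_nonzero)
      then show ?thesis using no_fixed_point[of "snd p /\<^sub>R fst p"] by simp
    qed
  qed measurable
  have "?K \<noteq> {}" by simp
  from continuous_attains_inf[OF compact_sphere this cont]
  obtain q where q: "q \<in> ?K" "\<And>p. p \<in> ?K \<Longrightarrow> f q \<le> f p" by blast
  show thesis
  proof (rule that[of "f q"])
    fix x :: "real^'n"
    \<comment> \<open>Normalising \<open>(1, x)\<close> divides the displacement by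
      \<open>t\<close>, and \<open>t\<close> is at least 1, so the minimum over the sphere bounds
      the unnormalised displacement too.\<close>
    define t where "t = norm (1 :: real, x)"
    have "t \<ge> 1" by (auto simp: t_def norm_prod_def)
    have "norm ((1 :: real, x) /\<^sub>R t) = 1"
      unfolding norm_scaleR using \<open>t \<ge> 1\<close> by (simp add: t_def[symmetric] del: norm_Pair)
    then have "f q \<le> f ((1, x) /\<^sub>R t)"
      by (intro q) simp
    also have "\<dots> \<le> (\<integral>\<omega>. min 1 (norm (fst (\<omega> 0) *v x + snd (\<omega> 0) - x)) \<partial>S)"
      unfolding f_def
    proof (rule integral_mono)
      fix \<omega> :: "nat \<Rightarrow> 'n affine_map"
      have "F ((1, x) /\<^sub>R t) \<omega> = (fst (\<omega> 0) *v x + snd (\<omega> 0) - x) /\<^sub>R t"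
        by (simp add: F_def linear_scale[OF matrix_vector_mul_linear] scaleR_add_right scaleR_diff_right)
      then have "norm (F ((1, x) /\<^sub>R t) \<omega>) = norm (fst (\<omega> 0) *v x + snd (\<omega> 0) - x) / t"
        using \<open>t \<ge> 1\<close> by (simp add: divide_inverse mult.commute)
      also have "\<dots> \<le> norm (fst (\<omega> 0) *v x + snd (\<omega> 0) - x)"
        using \<open>t \<ge> 1\<close> by (simp add: divide_le_eq mult_left_le mult_ge1_I)
           (metis mult.right_neutral mult_left_mono norm_ge_zero)
      finally show "min 1 (norm (F ((1, x) /\<^sub>R t) \<omega>)) \<le> min 1 (norm (fst (\<omega> 0) *v x + snd (\<omega> 0) - x))"
        by (rule min.mono[OF order_refl])
    qed auto
    finally show "f q \<le> (\<integral>\<omega>. min 1 (norm (fst (\<omega> 0) *v x + snd (\<omega> 0) - x)) \<partial>S)" .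
  qed (use q pos in blast)
qed

end

section \<open>Remaining in a ball: repeated trials and the logarithmic bound\<close>

text \<open>With both the start and time \<open>n\<close> included, this is exactly the event that
  the exit time exceeds \<open>n\<close>.\<close>

definition stays :: "real \<Rightarrow> nat \<Rightarrow> real^'n \<Rightarrow> (nat \<Rightarrow> 'n affine_map) \<Rightarrow> bool" where
  "stays R n x \<omega> \<longleftrightarrow> (\<forall>k\<le>n. norm (orbit x k \<omega>) \<le> R)"

lemma stays_antimono: "stays R n x \<omega> \<Longrightarrow> m \<le> n \<Longrightarrow> stays R m x \<omega>"
  by (auto simp: stays_def)

lemma stays_add: "stays R (m + n) x \<omega> \<longleftrightarrow> stays R m x \<omega> \<and> stays R n (orbit x m \<omega>) (shift m \<omega>)"
proof
  assume *: "stays R (m + n) x \<omega>"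
  then have "norm (orbit x (m + k) \<omega>) \<le> R" if "k \<le> n" for k
    using that unfolding stays_def by auto
  with * show "stays R m x \<omega> \<and> stays R n (orbit x m \<omega>) (shift m \<omega>)"
    by (auto simp: stays_def orbit_add)
next
  assume *: "stays R m x \<omega> \<and> stays R n (orbit x m \<omega>) (shift m \<omega>)"
  show "stays R (m + n) x \<omega>"
    unfolding stays_def
  proof safe
    fix k assume "k \<le> m + n"
    show "norm (orbit x k \<omega>) \<le> R"
    proof (cases "k \<le> m")
      case False
      then obtain j where j: "k = m + j" "j \<le> n"
        using \<open>k \<le> m + n\<close> by (metis add_le_cancel_left le_add_diff_inverse nat_le_linear)
      then show ?thesis using * by (auto simp: orbit_add stays_def)
    qed (use * in \<open>auto simp: stays_def\<close>)
  qed
qed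

lemma stays_comb_seq [simp]: "n \<le> m \<Longrightarrow> stays R n x (comb_seq m \<omega> \<omega>') \<longleftrightarrow> stays R n x \<omega>"
  by (auto simp: stays_def)

lemma (in iid_affine) measurable_stays [measurable]: "Measurable.pred S (stays R n x)"
  unfolding stays_def[abs_def] by measurable

text \<open>Restart at time \<open>T\<close>: the new start is random, but the environment after
  \<open>T\<close> is independent of it and \<open>step\<close> is uniform in the start.\<close>

lemma (in iid_affine) prob_stays_power:
  assumes step: "\<And>x. P.prob {\<omega> \<in> space S. stays R T x \<omega>} \<le> q"
  shows "P.prob {\<omega> \<in> space S. stays R (j * T) x \<omega>} \<le> q ^ j"
proof (induction j arbitrary: x)
  case (Suc j)
  have q: "0 \<le> q" using step[of 0] measure_nonneg order_trans by blast
  define f :: "(nat \<Rightarrow> 'n affine_map) \<Rightarrow> real"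
    where "f = indicator {\<omega> \<in> space S. stays R (Suc j * T) x \<omega>}"
  have [measurable]: "f \<in> borel_measurable S" unfolding f_def by measurable
  have bnd: "\<bar>f \<omega>\<bar> \<le> 1" for \<omega> by (auto simp: f_def indicator_def)
  have ind: "integrable S (indicator {\<omega> \<in> space S. stays R n y \<omega>} :: _ \<Rightarrow> real)" for n y
    by (intro integrable_real_indicator) (auto simp: P.emeasure_eq_measure)
  have sp: "comb_seq T \<omega> \<omega>' \<in> space S" if "\<omega> \<in> space S" "\<omega>' \<in> space S" for \<omega> \<omega>'
    using that by (auto simp: space_PiM PiE_iff comb_seq_def)
  have "P.prob {\<omega> \<in> space S. stays R (Suc j * T) x \<omega>} = (\<integral>\<omega>. f \<omega> \<partial>S)"
    by (simp add: f_def)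
  also have "\<dots> = (\<integral>\<omega>. \<integral>\<omega>'. f (comb_seq T \<omega> \<omega>') \<partial>S \<partial>S)"
    by (rule expectation_comb_seq[OF _ bnd]) measurable
  also have "\<dots> \<le> (\<integral>\<omega>. q ^ j * indicator {\<omega> \<in> space S. stays R T x \<omega>} \<omega> \<partial>S)"
  proof (rule integral_mono)
    show "integrable S (\<lambda>\<omega>. \<integral>\<omega>'. f (comb_seq T \<omega> \<omega>') \<partial>S)"
      by (rule integrable_comb_seq[OF _ bnd]) measurable
    show "integrable S (\<lambda>\<omega>. q ^ j * indicator {\<omega> \<in> space S. stays R T x \<omega>} \<omega> :: real)"
      by (intro integrable_mult_right ind)
    fix \<omega> assume \<omega>: "\<omega> \<in> space S"
    have "(\<integral>\<omega>'. f (comb_seq T \<omega> \<omega>') \<partial>S) = (\<integral>\<omega>'. indicator {\<omega> \<in> space S. stays R T x \<omega>} \<omega> *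
        indicator {\<omega>' \<in> space S. stays R (j * T) (orbit x T \<omega>) \<omega>'} \<omega>' \<partial>S)"
      by (rule Bochner_Integration.integral_cong)
         (auto simp: f_def stays_add \<omega> sp split: split_indicator)
    also have "\<dots> = indicator {\<omega> \<in> space S. stays R T x \<omega>} \<omega> *
        P.prob {\<omega>' \<in> space S. stays R (j * T) (orbit x T \<omega>) \<omega>'}"
      by simp
    also have "\<dots> \<le> indicator {\<omega> \<in> space S. stays R T x \<omega>} \<omega> * q ^ j"
      by (intro mult_left_mono Suc.IH) auto
    finally show "(\<integral>\<omega>'. f (comb_seq T \<omega> \<omega>') \<partial>S) \<le> q ^ j * indicator {\<omega> \<in> space S. stays R T x \<omega>} \<omega>"
      by (simp add: mult.commute)
  qed
  also have "\<dots> = q ^ j * P.prob {\<omega> \<in> space S. stays R T x \<omega>}"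
    by simp
  also have "\<dots> \<le> q ^ Suc j"
    using mult_left_mono[OF step, of "q ^ j" x] q by (simp add: mult.commute)
  finally show ?case .
qed (simp add: P.prob_le_1)

text \<open>The left side is the expected exit time as a sum of tail probabilities. Grouped into
  blocks of length \<open>T\<close>, the tails are dominated by a geometric series with sum
  1/\<kappa>.\<close>

lemma (in iid_affine) suminf_prob_stays_le:
  assumes step: "\<And>x. P.prob {\<omega> \<in> space S. stays R T x \<omega>} \<le> 1 - \<kappa>" and "0 < \<kappa>" "0 < T"
  shows "(\<Sum>n. ennreal (P.prob {\<omega> \<in> space S. stays R n x \<omega>})) \<le> ennreal (real T / \<kappa>)"
proof -
  let ?u = "\<lambda>n. P.prob {\<omega> \<in> space S. stays R n x \<omega>}"
  have "\<kappa> \<le> 1" using step[of 0] measure_nonneg[of S] by (smt (verit))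
  have mono: "?u n \<le> ?u m" if "m \<le> n" for m n
    using that by (intro P.finite_measure_mono) (auto intro: stays_antimono)
  have partial: "(\<Sum>n<j * T. ?u n) \<le> real T * (\<Sum>i<j. (1 - \<kappa>) ^ i)" for j
  proof (induction j)
    case (Suc j)
    have "(\<Sum>n<Suc j * T. ?u n) = (\<Sum>n<j * T. ?u n) + (\<Sum>n=j * T..<Suc j * T. ?u n)"
      by (simp add: lessThan_atLeast0 sum.atLeastLessThan_concat)
    also have "(\<Sum>n=j * T..<Suc j * T. ?u n) \<le> (\<Sum>n=j * T..<Suc j * T. (1 - \<kappa>) ^ j)"
    proof (rule sum_mono)
      fix n assume "n \<in> {j * T..<Suc j * T}"
      then have "?u n \<le> ?u (j * T)" by (intro mono) auto
      also have "\<dots> \<le> (1 - \<kappa>) ^ j" by (rule prob_stays_power[OF step])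
      finally show "?u n \<le> (1 - \<kappa>) ^ j" .
    qed
    finally show ?case using Suc by (simp add: algebra_simps)
  qed simp
  have geo: "(\<Sum>i<j. (1 - \<kappa>) ^ i) \<le> 1 / \<kappa>" for j
  proof -
    have "(\<Sum>i<j. (1 - \<kappa>) ^ i) = (1 - (1 - \<kappa>) ^ j) / \<kappa>"
      using \<open>0 < \<kappa>\<close> by (simp add: sum_gp_strict)
    also have "\<dots> \<le> 1 / \<kappa>"
      using \<open>0 < \<kappa>\<close> \<open>\<kappa> \<le> 1\<close> by (intro divide_right_mono) auto
    finally show ?thesis .
  qed
  have "(\<Sum>n<k. ?u n) \<le> real T / \<kappa>" for k
  proof -
    have "(\<Sum>n<k. ?u n) \<le> (\<Sum>n<k * T. ?u n)"
      using \<open>0 < T\<close> by (intro sum_mono2) auto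
    also have "\<dots> \<le> real T * (1 / \<kappa>)"
      by (rule order_trans[OF partial]) (intro mult_left_mono geo, simp)
    finally show ?thesis by simp
  qed
  then have "(\<Sum>n<k. ennreal (?u n)) \<le> ennreal (real T / \<kappa>)" for k
    by (simp add: sum_ennreal ennreal_leI)
  then show ?thesis
    by (intro suminf_le_const summableI)
qed

context expanding_affine
begin

lemma prob_stays_le:
  obtains N\<^sub>0 m\<^sub>0 \<kappa> where "0 < \<kappa>"
    "\<And>N R x. N\<^sub>0 \<le> N \<Longrightarrow> R * exp (- c * real N) \<le> \<kappa> \<Longrightarrow>
       P.prob {\<omega> \<in> space S. stays R (N + m\<^sub>0 + 1) x \<omega>} \<le> 1 - \<kappa>"
proof -
  obtain N\<^sub>0 m\<^sub>0 \<eta> where "\<eta> > 0" and \<eta>: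
    "\<And>N v. N\<^sub>0 \<le> N \<Longrightarrow> \<eta> * min 1 (norm v)
       \<le> (\<Sum>m\<le>m\<^sub>0. \<integral>\<omega>. min 1 (exp (- c * real N) * norm (cocycle (m + N) \<omega> *v v)) \<partial>S)"
    by (rule expectation_rescaled_cocycle_ge) blast
  obtain \<epsilon> where "\<epsilon> > 0" and \<epsilon>:
    "\<And>x. \<epsilon> \<le> (\<integral>\<omega>. min 1 (norm (fst (\<omega> 0) *v x + snd (\<omega> 0) - x)) \<partial>S)"
    by (rule expectation_displacement_ge) blast
  \<comment> \<open>Chosen so that the lower bound averages to 4 \<kappa> per value of
    \<open>m\<close>. The event that both processes stay accounts for 2 \<kappa>, and the remaining
    2 \<kappa> bound twice the exit probability.\<close>
  define \<kappa> where "\<kappa> = \<eta> * \<epsilon> / (4 * (real m\<^sub>0 + 1))"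
  have "\<kappa> > 0" using \<open>\<eta> > 0\<close> \<open>\<epsilon> > 0\<close> by (simp add: \<kappa>_def)
  show thesis
  proof (rule that[OF \<open>\<kappa> > 0\<close>])
    fix N :: nat and R :: real and x :: "real^'n"
    assume N: "N\<^sub>0 \<le> N" and R: "R * exp (- c * real N) \<le> \<kappa>"
    \<comment> \<open>One step for the displacement, then at most \<open>m\<^sub>0 + N\<close> steps
      for the product.\<close>
    define T where "T = N + m\<^sub>0 + 1"
    define v where "v \<omega> = orbit x 1 \<omega> - x" for \<omega> :: "nat \<Rightarrow> 'n affine_map"
    define h where "h m \<omega> = min 1 (exp (- c * real N) * norm (cocycle (m + N) (shift 1 \<omega>) *v v \<omega>))"
      for m and \<omega> :: "nat \<Rightarrow> 'n affine_map"
    have [measurable]: "v \<in> borel_measurable S"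
      unfolding v_def[abs_def] by measurable
    have h_meas [measurable]: "h m \<in> borel_measurable S" for m
      unfolding h_def[abs_def] by measurable
    have bnd: "\<bar>h m \<omega>\<bar> \<le> 1" for m \<omega> by (auto simp: h_def)
    \<comment> \<open>The displacement uses only the first coordinate and the product only the later
      ones; this is their independence.\<close>
    have h_comb: "h m (comb_seq 1 \<omega> \<omega>') = min 1 (exp (- c * real N) * norm (cocycle (m + N) \<omega>' *v v \<omega>))"
      for m \<omega> \<omega>'
      by (simp add: h_def v_def del: comb_seq_Suc_0 One_nat_def)
    have v_min: "(\<integral>\<omega>. min 1 (norm (v \<omega>)) \<partial>S) \<ge> \<epsilon>"
      using \<epsilon>[of x] by (simp add: v_def)
    have "\<eta> * \<epsilon> \<le> \<eta> * (\<integral>\<omega>. min 1 (norm (v \<omega>)) \<partial>S)"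
      using v_min \<open>\<eta> > 0\<close> by (intro mult_left_mono) auto
    also have "\<dots> = (\<integral>\<omega>. \<eta> * min 1 (norm (v \<omega>)) \<partial>S)"
      by simp
    also have "\<dots> \<le> (\<integral>\<omega>. (\<Sum>m\<le>m\<^sub>0. \<integral>\<omega>'. h m (comb_seq 1 \<omega> \<omega>') \<partial>S) \<partial>S)"
    proof (rule integral_mono)
      show "integrable S (\<lambda>\<omega>. \<Sum>m\<le>m\<^sub>0. \<integral>\<omega>'. h m (comb_seq 1 \<omega> \<omega>') \<partial>S)"
        by (intro Bochner_Integration.integrable_sum integrable_comb_seq[OF h_meas bnd])
      show "\<eta> * min 1 (norm (v \<omega>)) \<le> (\<Sum>m\<le>m\<^sub>0. \<integral>\<omega>'. h m (comb_seq 1 \<omega> \<omega>') \<partial>S)" for \<omega>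
        unfolding h_comb by (rule \<eta>[OF N])
    qed simp
    also have "\<dots> = (\<Sum>m\<le>m\<^sub>0. \<integral>\<omega>. h m \<omega> \<partial>S)"
      by (subst Bochner_Integration.integral_sum[OF integrable_comb_seq[OF h_meas bnd]])
         (intro sum.cong refl expectation_comb_seq[OF h_meas bnd, symmetric])
    also have "\<dots> \<le> (\<Sum>m\<le>m\<^sub>0. 2 * \<kappa> + 2 * (1 - P.prob {\<omega> \<in> space S. stays R T x \<omega>}))"
    proof (rule sum_mono)
      fix m assume "m \<in> {..m\<^sub>0}"
      \<comment> \<open>Outside both exit events \<open>h m\<close> is at most 2 \<kappa>, on them
        at most 1, and the shift gives the two events equal probability.\<close>
      define A where "A = {\<omega> \<in> space S. \<not> stays R T x \<omega>}"
      define A' where "A' = {\<omega> \<in> space S. \<not> stays R T x (shift 1 \<omega>)}"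
      have [measurable]: "A \<in> sets S" "A' \<in> sets S"
        unfolding A_def A'_def by measurable
      have "integrable S (h m)"
        by (rule P.integrable_const_bound[of _ 1]) (auto simp: bnd)
      have ind: "integrable S (indicator A :: _ \<Rightarrow> real)" "integrable S (indicator A' :: _ \<Rightarrow> real)"
        by (auto intro!: integrable_real_indicator simp: P.emeasure_eq_measure)
      have "(\<integral>\<omega>. h m \<omega> \<partial>S) \<le> (\<integral>\<omega>. 2 * \<kappa> + (indicator A \<omega> + indicator A' \<omega>) \<partial>S)"
      proof (rule integral_mono[OF \<open>integrable S (h m)\<close>])
        fix \<omega> assume \<omega>: "\<omega> \<in> space S"
        show "h m \<omega> \<le> 2 * \<kappa> + (indicator A \<omega> + indicator A' \<omega>)"
        proof (cases "\<omega> \<in> A \<or> \<omega> \<in> A'")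
          case True
          have "h m \<omega> \<le> 1" by (simp add: h_def)
          then show ?thesis using True \<open>\<kappa> > 0\<close> by (auto split: split_indicator)
        next
          case False
          then have stay: "stays R T x \<omega>" "stays R T x (shift 1 \<omega>)"
            using \<omega> by (auto simp: A_def A'_def)
          \<comment> \<open>Both orbits run in the shifted environment, one from the position after
            the first step and one from \<open>x\<close>, so two positions in the ball of radius
            \<open>R\<close> bound the product by 2 \<open>R\<close>.\<close>
          have "cocycle (m + N) (shift 1 \<omega>) *v v \<omega>
              = orbit x (1 + (m + N)) \<omega> - orbit x (m + N) (shift 1 \<omega>)"
            unfolding orbit_add v_def orbit_diff[symmetric] ..
          also have "norm \<dots> \<le> R + R"
            using stay \<open>m \<in> {..m\<^sub>0}\<close> unfolding stays_def T_def
            by (intro order_trans[OF norm_triangle_ineq4] add_mono)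
              (simp_all del: orbit.simps)
          finally have "exp (- c * real N) * norm (cocycle (m + N) (shift 1 \<omega>) *v v \<omega>)
              \<le> exp (- c * real N) * (R + R)"
            by (intro mult_left_mono) auto
          also have "\<dots> \<le> 2 * \<kappa>" using R by (simp add: algebra_simps)
          finally show ?thesis using False by (simp add: h_def)
        qed
      qed (intro Bochner_Integration.integrable_add ind P.integrable_const)
      also have "\<dots> = 2 * \<kappa> + (P.prob A + P.prob A')"
        using ind by (simp add: P.prob_space)
      also have "P.prob A' = P.prob A"
        unfolding A_def A'_def by (rule prob_shift) measurable
      also have "P.prob A = 1 - P.prob {\<omega> \<in> space S. stays R T x \<omega>}"
        unfolding A_def by (rule P.prob_neg) measurable
      finally show "(\<integral>\<omega>. h m \<omega> \<partial>S) \<le> 2 * \<kappa> + 2 * (1 - P.prob {\<omega> \<in> space S. stays R T x \<omega>})"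
        by simp
    qed
    also have "\<dots> = (real m\<^sub>0 + 1) * (2 * \<kappa> + 2 * (1 - P.prob {\<omega> \<in> space S. stays R T x \<omega>}))"
      by simp
    also have "\<eta> * \<epsilon> = (real m\<^sub>0 + 1) * (4 * \<kappa>)"
      by (simp add: \<kappa>_def add_pos_nonneg field_simps)
    finally have "4 * \<kappa> \<le> 2 * \<kappa> + 2 * (1 - P.prob {\<omega> \<in> space S. stays R T x \<omega>})"
      by (rule mult_left_le_imp_le) simp
    then show "P.prob {\<omega> \<in> space S. stays R (N + m\<^sub>0 + 1) x \<omega>} \<le> 1 - \<kappa>"
      unfolding T_def by simp
  qed
qed

lemma suminf_prob_stays_le_ln:
  obtains K L where "\<And>R x. 1 \<le> R \<Longrightarrow>
    (\<Sum>n. ennreal (P.prob {\<omega> \<in> space S. stays R n x \<omega>})) \<le> ennreal (K + L * ln R)"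
proof -
  obtain N\<^sub>0 m\<^sub>0 \<kappa> where "0 < \<kappa>" and \<kappa>:
    "\<And>N R x. N\<^sub>0 \<le> N \<Longrightarrow> R * exp (- c * real N) \<le> \<kappa> \<Longrightarrow>
       P.prob {\<omega> \<in> space S. stays R (N + m\<^sub>0 + 1) x \<omega>} \<le> 1 - \<kappa>"
    by (rule prob_stays_le) blast
  show thesis
  proof (rule that)
    fix R :: real and x :: "real^'n"
    assume "1 \<le> R"
    \<comment> \<open>The time at which \<open>R * exp (- c * y)\<close> equals \<kappa>; it may be
      negative, which \<open>nat\<close> turns into 0 in the next line.\<close>
    define y where "y = (ln R - ln \<kappa>) / c"
    define N where "N = N\<^sub>0 + nat \<lceil>y\<rceil>"
    have "y \<le> real N" unfolding N_def by linarith
    then have "ln R - ln \<kappa> \<le> c * real N"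
      using c_pos by (simp add: y_def divide_le_eq mult.commute)
    then have "exp (ln R - c * real N) \<le> exp (ln \<kappa>)"
      by simp
    then have "R * exp (- c * real N) \<le> \<kappa>"
      using \<open>1 \<le> R\<close> \<open>0 < \<kappa>\<close> by (simp add: exp_diff exp_minus divide_inverse)
    then have "(\<Sum>n. ennreal (P.prob {\<omega> \<in> space S. stays R n x \<omega>})) \<le> ennreal (real (N + m\<^sub>0 + 1) / \<kappa>)"
      by (intro suminf_prob_stays_le \<kappa> \<open>0 < \<kappa>\<close>) (auto simp: N_def)
    also have "\<dots> \<le> ennreal ((real N\<^sub>0 + real m\<^sub>0 + 2 + \<bar>ln \<kappa>\<bar> / c) / \<kappa> + (1 / (c * \<kappa>)) * ln R)"
    proof (rule ennreal_leI)
      have "y \<le> ln R / c + \<bar>ln \<kappa>\<bar> / c"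
        unfolding y_def add_divide_distrib[symmetric] using c_pos by (intro divide_right_mono) auto
      moreover have "0 \<le> ln R / c + \<bar>ln \<kappa>\<bar> / c"
        using \<open>1 \<le> R\<close> c_pos by simp
      ultimately have "real (nat \<lceil>y\<rceil>) \<le> ln R / c + \<bar>ln \<kappa>\<bar> / c + 1"
        by linarith
      then have "real (N + m\<^sub>0 + 1) / \<kappa> \<le> (real N\<^sub>0 + real m\<^sub>0 + 2 + \<bar>ln \<kappa>\<bar> / c + ln R / c) / \<kappa>"
        using \<open>0 < \<kappa>\<close> by (intro divide_right_mono) (auto simp: N_def)
      then show "real (N + m\<^sub>0 + 1) / \<kappa>
          \<le> (real N\<^sub>0 + real m\<^sub>0 + 2 + \<bar>ln \<kappa>\<bar> / c) / \<kappa> + (1 / (c * \<kappa>)) * ln R"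
        by (simp add: add_divide_distrib)
    qed
    finally show "(\<Sum>n. ennreal (P.prob {\<omega> \<in> space S. stays R n x \<omega>}))
      \<le> ennreal ((real N\<^sub>0 + real m\<^sub>0 + 2 + \<bar>ln \<kappa>\<bar> / c) / \<kappa> + (1 / (c * \<kappa>)) * ln R)" .
  qed
qed

end

section \<open>Lower bound: slow growth under logarithmic integrability\<close>

text \<open>Its exponential bounds the factor by which \<open>1 + norm\<close> of the position can
  grow in one step; the summand 1 also makes it nonnegative.\<close>

definition log_size :: "'n::finite affine_map \<Rightarrow> real" where
  "log_size a = ln (1 + norm (fst a) + norm (snd a))"

lemma log_size_nonneg: "0 \<le> log_size a"
  by (simp add: log_size_def add_nonneg_nonneg)

lemma norm_orbit_le: "1 + norm (orbit x n \<omega>) \<le> (1 + norm x) * exp (\<Sum>i<n. log_size (\<omega> i))"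
proof (induction n)
  case (Suc n)
  let ?s = "1 + norm (fst (\<omega> n)) + norm (snd (\<omega> n))"
  have "0 < ?s" by (simp add: add_pos_nonneg)
  have "1 + norm (orbit x (Suc n) \<omega>)
      \<le> 1 + (norm (fst (\<omega> n)) * norm (orbit x n \<omega>) + norm (snd (\<omega> n)))"
    using norm_triangle_ineq[of "fst (\<omega> n) *v orbit x n \<omega>" "snd (\<omega> n)"]
      norm_matrix_vector_mult_le[of "fst (\<omega> n)" "orbit x n \<omega>"] by simp
  also have "\<dots> \<le> ?s * (1 + norm (orbit x n \<omega>))"
    by (simp add: algebra_simps)
  also have "\<dots> \<le> ?s * ((1 + norm x) * exp (\<Sum>i<n. log_size (\<omega> i)))"
    by (intro mult_left_mono Suc.IH) simp
  also have "?s = exp (log_size (\<omega> n))"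
    unfolding log_size_def using \<open>0 < ?s\<close> by simp
  finally show ?case by (simp add: exp_add mult_ac)
qed simp

context iid_affine
begin

lemma measurable_log_size [measurable]: "(\<lambda>\<omega>. log_size (\<omega> n)) \<in> borel_measurable S"
  unfolding log_size_def by measurable

text \<open>Peel off the first block: the orbit of 0 is the product from the next block boundary,
  applied to the position reached there, plus the orbit of 0 restarted at that boundary. Each block
  thus adds one term \<open>D * U\<close>, so the bound is linear in the number of blocks and needs
  products from boundaries only.\<close>

lemma orbit_le_if_blocks_le:
  assumes block: "\<And>j r. j < J \<Longrightarrow> r \<le> L \<Longrightarrow> norm (orbit 0 r (shift (j * L) \<omega>)) \<le> U"
    and coc: "\<And>j n. j \<le> J \<Longrightarrow> n \<le> J * L \<Longrightarrow> norm (cocycle n (shift (j * L) \<omega>)) \<le> D"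
    and "0 \<le> U" "0 \<le> D"
  shows "j + s \<le> J \<Longrightarrow> n \<le> j * L \<Longrightarrow> norm (orbit 0 n (shift (s * L) \<omega>)) \<le> real j * (D * U) + U"
proof (induction j arbitrary: s n)
  case (Suc j)
  have "0 \<le> D * U" using assms(3,4) by simp
  show ?case
  proof (cases "n \<le> L")
    case True
    then have "norm (orbit 0 n (shift (s * L) \<omega>)) \<le> U"
      using Suc.prems by (intro block) auto
    moreover have "0 \<le> real (Suc j) * (D * U)"
      by (rule mult_nonneg_nonneg[OF of_nat_0_le_iff \<open>0 \<le> D * U\<close>])
    ultimately show ?thesis by linarith
  next
    case False
    then obtain m where m: "n = L + m" by (metis le_add_diff_inverse nat_le_linear)
    have m_le: "m \<le> j * L" using Suc.prems m by simp
    have "m \<le> J * L"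
      using m_le Suc.prems(1) by (meson add_leD1 le_trans mult_le_mono1 Suc_leD add_Suc)
    define y where "y = orbit 0 L (shift (s * L) \<omega>)"
    let ?\<omega> = "shift (Suc s * L) \<omega>"
    have "orbit 0 n (shift (s * L) \<omega>) = orbit y m ?\<omega>"
      unfolding m orbit_add y_def by (simp add: add.commute)
    also have "\<dots> = cocycle m ?\<omega> *v y + orbit 0 m ?\<omega>"
      using orbit_diff[of y m ?\<omega> 0] by (simp add: algebra_simps)
    also have "norm \<dots> \<le> D * U + (real j * (D * U) + U)"
    proof (intro order_trans[OF norm_triangle_ineq] add_mono)
      have "norm (cocycle m ?\<omega>) \<le> D"
        using Suc.prems(1) \<open>m \<le> J * L\<close> by (intro coc) auto
      moreover have "norm y \<le> U"
        unfolding y_def using Suc.prems(1) by (intro block) auto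
      ultimately show "norm (cocycle m ?\<omega> *v y) \<le> D * U"
        using \<open>0 \<le> D\<close> by (intro order_trans[OF norm_matrix_vector_mult_le] mult_mono) auto
      show "norm (orbit 0 m ?\<omega>) \<le> real j * (D * U) + U"
        using Suc.prems(1) m_le by (intro Suc.IH) auto
    qed
    finally show ?thesis by (simp add: algebra_simps)
  qed
qed (use assms(3) in simp)

lemma expectation_coordinate_shift:
  fixes f :: "'n affine_map \<Rightarrow> real"
  assumes [measurable]: "(\<lambda>\<omega>. f (\<omega> 0)) \<in> borel_measurable S"
  shows "(\<integral>\<omega>. f (\<omega> i) \<partial>S) = (\<integral>\<omega>. f (\<omega> 0) \<partial>S)"
    and "integrable S (\<lambda>\<omega>. f (\<omega> i)) \<longleftrightarrow> integrable S (\<lambda>\<omega>. f (\<omega> 0))"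
proof -
  have "(\<integral>\<omega>. f (\<omega> 0) \<partial>S) = (\<integral>\<omega>. f (\<omega> 0) \<partial>distr S S (shift i))"
    unfolding distr_shift ..
  also have "\<dots> = (\<integral>\<omega>. f (shift i \<omega> 0) \<partial>S)"
    by (rule integral_distr) measurable
  finally show "(\<integral>\<omega>. f (\<omega> i) \<partial>S) = (\<integral>\<omega>. f (\<omega> 0) \<partial>S)"
    by (simp add: shift_def)
  have "integrable S (\<lambda>\<omega>. f (\<omega> 0)) \<longleftrightarrow> integrable (distr S S (shift i)) (\<lambda>\<omega>. f (\<omega> 0))"
    unfolding distr_shift ..
  also have "\<dots> \<longleftrightarrow> integrable S (\<lambda>\<omega>. f (shift i \<omega> 0))"
    by (rule integrable_distr_eq) measurable
  finally show "integrable S (\<lambda>\<omega>. f (\<omega> i)) \<longleftrightarrow> integrable S (\<lambda>\<omega>. f (\<omega> 0))"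
    by (simp add: shift_def)
qed

lemma expectation_excess_tendsto_0:
  assumes "integrable S (\<lambda>\<omega>. log_size (\<omega> 0))"
  shows "(\<lambda>k. \<integral>\<omega>. max 0 (log_size (\<omega> 0) - real k) \<partial>S) \<longlonglongrightarrow> 0"
proof -
  have "(\<lambda>k. \<integral>\<omega>. max 0 (log_size (\<omega> 0) - real k) \<partial>S) \<longlonglongrightarrow> (\<integral>\<omega>. 0 \<partial>S)"
  proof (rule integral_dominated_convergence[where w = "\<lambda>\<omega>. log_size (\<omega> 0)"])
    show "AE \<omega> in S. (\<lambda>k. max 0 (log_size (\<omega> 0) - real k)) \<longlonglongrightarrow> 0"
    proof (intro AE_I2 tendsto_eventually)
      fix \<omega> :: "nat \<Rightarrow> 'n affine_map"
      show "\<forall>\<^sub>F k in sequentially. max 0 (log_size (\<omega> 0) - real k) = 0"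
        using eventually_ge_at_top[of "nat \<lceil>log_size (\<omega> 0)\<rceil>"]
        by eventually_elim linarith
    qed
    show "AE \<omega> in S. norm (max 0 (log_size (\<omega> 0) - real k)) \<le> log_size (\<omega> 0)" for k
      by (auto simp: log_size_nonneg)
  qed (use assms in auto)
  then show ?thesis by simp
qed

text \<open>Markov's inequality: the mean of the sum is proportional to \<open>N\<close>, which
  cancels, and the mean excess of one term is small once the truncation level is high.\<close>

lemma prob_sum_excess_ge_le:
  assumes int: "integrable S (\<lambda>\<omega>. log_size (\<omega> 0))" and "0 < a" "0 < N"
  shows "P.prob {\<omega> \<in> space S. a * real N \<le> (\<Sum>i<N. max 0 (log_size (\<omega> i) - k))}
    \<le> (\<integral>\<omega>. max 0 (log_size (\<omega> 0) - k) \<partial>S) / a"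
proof -
  let ?e = "\<lambda>i \<omega>. max 0 (log_size (\<omega> i) - k)"
  have int0: "integrable S (?e 0)" using int by simp
  have e: "integrable S (?e i)" "(\<integral>\<omega>. ?e i \<omega> \<partial>S) = (\<integral>\<omega>. ?e 0 \<omega> \<partial>S)" for i
    using expectation_coordinate_shift[of "\<lambda>x. max 0 (log_size x - k)" i] int0 by simp_all
  have "P.prob {\<omega> \<in> space S. a * real N \<le> (\<Sum>i<N. ?e i \<omega>)} \<le> (\<integral>\<omega>. (\<Sum>i<N. ?e i \<omega>) \<partial>S) / (a * real N)"
    using \<open>0 < a\<close> \<open>0 < N\<close>
    by (intro integral_Markov_inequality_measure[where A = "{}"]) (auto intro!: e sum_nonneg AE_I2)
  also have "(\<integral>\<omega>. (\<Sum>i<N. ?e i \<omega>) \<partial>S) = (\<Sum>i<N. \<integral>\<omega>. ?e i \<omega> \<partial>S)"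
    by (rule Bochner_Integration.integral_sum[OF e(1)])
  also have "\<dots> = (\<Sum>i<N. \<integral>\<omega>. ?e 0 \<omega> \<partial>S)"
    by (intro sum.cong refl e(2))
  finally show ?thesis using \<open>0 < N\<close> by simp
qed

text \<open>All times up to \<open>K\<close> are controlled at once because the bound is the one for
  time \<open>K\<close>. The finitely many times before the almost sure bound sets in contribute a
  random constant \<open>Z\<close>, which \<open>exp (b' * real K)\<close> overtakes.\<close>

lemma prob_cocycle_le_tendsto_1:
  assumes growth_le: "AE \<omega> in S. \<forall>\<^sub>F n in sequentially. norm (cocycle n \<omega>) \<le> exp (b * real n)"
    and "0 \<le> b" "b < b'"
  shows "(\<lambda>K. P.prob {\<omega> \<in> space S. \<forall>n\<le>K. norm (cocycle n \<omega>) \<le> exp (b' * real K)}) \<longlonglongrightarrow> 1"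
proof (rule P.prob_tendsto_1_if_AE_eventually)
  show "AE \<omega> in S. \<forall>\<^sub>F K in sequentially. \<forall>n\<le>K. norm (cocycle n \<omega>) \<le> exp (b' * real K)"
    using growth_le
  proof eventually_elim
    case (elim \<omega>)
    then obtain n\<^sub>0 where n0: "\<And>n. n\<^sub>0 \<le> n \<Longrightarrow> norm (cocycle n \<omega>) \<le> exp (b * real n)"
      by (auto simp: eventually_sequentially)
    define Z where "Z = Max ((\<lambda>n. norm (cocycle n \<omega>)) ` {..n\<^sub>0})"
    have "filterlim (\<lambda>K. exp (b' * real K)) at_top sequentially"
      using assms(2,3) by (intro filterlim_exp_mult_real) simp
    then have "\<forall>\<^sub>F K in sequentially. Z \<le> exp (b' * real K)"
      by (auto simp: filterlim_at_top)
    then show ?case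
    proof eventually_elim
      case (elim K)
      show ?case
      proof (intro allI impI)
        fix n assume "n \<le> K"
        show "norm (cocycle n \<omega>) \<le> exp (b' * real K)"
        proof (cases "n \<le> n\<^sub>0")
          case True
          then have "norm (cocycle n \<omega>) \<le> Z" unfolding Z_def by (intro Max_ge) auto
          then show ?thesis using elim by simp
        next
          case False
          then have "norm (cocycle n \<omega>) \<le> exp (b * real n)" by (intro n0) simp
          also have "b * real n \<le> b' * real K"
            using \<open>n \<le> K\<close> assms(2,3) by (intro mult_mono) auto
          finally show ?thesis by simp
        qed
      qed
    qed
  qed
qed measurable

text \<open>
  The time interval is cut into a fixed number \<open>J\<close> of blocks of length \<open>L\<close>. Inside a block the
  trivial bound by \<^const>\<open>log_size\<close> suffices, as a block is a small fraction of the interval;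
  the growth rate of the matrix products is needed from the \<open>J\<close> block boundaries only, where a
  union bound is affordable.
\<close>

lemma prob_stays_ge:
  assumes growth_le: "\<And>b. g < b \<Longrightarrow> AE \<omega> in S. \<forall>\<^sub>F n in sequentially. norm (cocycle n \<omega>) \<le> exp (b * real n)"
    and int: "integrable S (\<lambda>\<omega>. log_size (\<omega> 0))"
    and "0 \<le> g" "g < b" "q < 1"
  obtains J where "0 < J" "\<forall>\<^sub>F L in sequentially.
    q \<le> P.prob {\<omega> \<in> space S. stays (exp (b * real (J * L))) (J * L) x \<omega>}"
proof -
  \<comment> \<open>Budget for the exponent \<open>b = g + 4 * a\<close>: \<open>g + 2 * a\<close>
    for the products, \<open>a\<close> for growth inside a block, \<open>a\<close> for the factor
    \<open>real J + 1 + norm x\<close>.\<close>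
  define a where "a = (b - g) / 4"
  have "a > 0" using \<open>g < b\<close> by (simp add: a_def)
  \<comment> \<open>There are two sources of failure, the excesses and the products, each allowed
    probability \<delta>.\<close>
  define \<delta> where "\<delta> = (1 - q) / 2"
  have "\<delta> > 0" using \<open>q < 1\<close> by (simp add: \<delta>_def)
  have "\<forall>\<^sub>F k in sequentially. (\<integral>\<omega>. max 0 (log_size (\<omega> 0) - real k) \<partial>S) < \<delta> * (a / 2)"
    using \<open>\<delta> > 0\<close> \<open>a > 0\<close> by (intro order_tendstoD(2)[OF expectation_excess_tendsto_0[OF int]]) auto
  then obtain k :: nat where k: "(\<integral>\<omega>. max 0 (log_size (\<omega> 0) - real k) \<partial>S) < \<delta> * (a / 2)"
    by (auto simp: eventually_sequentially)
  \<comment> \<open>The truncation level is fixed first and the number of blocks afterwards: the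
    truncated parts in one block then sum to at most \<open>k * L\<close>, which is at most
    \<open>a / 2 * K\<close>, and the excesses may use the other half of \<open>a\<close>.\<close>
  obtain J :: nat where J: "real k / (a / 2) \<le> real J" "0 < J"
  proof
    show "real k / (a / 2) \<le> real (nat \<lceil>real k / (a / 2)\<rceil> + 1)" by linarith
  qed simp
  have kJ: "real k \<le> a / 2 * real J"
    using J \<open>a > 0\<close> by (simp add: divide_le_eq mult.commute)
  define p where "p K = P.prob {\<omega> \<in> space S. \<forall>n\<le>K. norm (cocycle n \<omega>) \<le> exp ((g + 2 * a) * real K)}" for K
  have "p \<longlonglongrightarrow> 1"
    unfolding p_def[abs_def] using \<open>a > 0\<close> \<open>0 \<le> g\<close>
    by (intro prob_cocycle_le_tendsto_1[OF growth_le, of "g + a"]) auto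
  then have "(\<lambda>L. p (J * L)) \<longlonglongrightarrow> 1"
    using \<open>0 < J\<close> by (intro filterlim_compose[OF _ mult_nat_left_at_top]) auto
  then have "(\<lambda>L. (real J + 1) * (1 - p (J * L))) \<longlonglongrightarrow> (real J + 1) * (1 - 1)"
    by (intro tendsto_intros)
  then have ev1: "\<forall>\<^sub>F L in sequentially. (real J + 1) * (1 - p (J * L)) < \<delta>"
    using \<open>\<delta> > 0\<close> by (intro order_tendstoD(2)) auto
  have "filterlim (\<lambda>K. exp (a * real K)) at_top sequentially"
    by (rule filterlim_exp_mult_real[OF \<open>a > 0\<close>])
  then have "filterlim (\<lambda>L. exp (a * real (J * L))) at_top sequentially"
    using \<open>0 < J\<close> by (rule filterlim_compose[OF _ mult_nat_left_at_top])
  then have ev2: "\<forall>\<^sub>F L in sequentially. real J + 1 + norm x \<le> exp (a * real (J * L))"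
    by (auto simp: filterlim_at_top)
  have "\<forall>\<^sub>F L in sequentially.
    q \<le> P.prob {\<omega> \<in> space S. stays (exp (b * real (J * L))) (J * L) x \<omega>}"
    using ev1 ev2 eventually_gt_at_top[of 0]
  proof eventually_elim
    case (elim L)
    define K where "K = J * L"
    have "0 < K" using \<open>0 < J\<close> elim by (simp add: K_def)
    define E1 where "E1 = {\<omega> \<in> space S. a / 2 * real K \<le> (\<Sum>i<K. max 0 (log_size (\<omega> i) - real k))}"
    define E2 where "E2 j = {\<omega> \<in> space S. \<not> (\<forall>n\<le>K. norm (cocycle n (shift (j * L) \<omega>)) \<le> exp ((g + 2 * a) * real K))}" for j
    define G where "G = {\<omega> \<in> space S. stays (exp (b * real K)) K x \<omega>}"
    have [measurable]: "E1 \<in> sets S" "E2 j \<in> sets S" "G \<in> sets S" for j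
      unfolding E1_def E2_def G_def by measurable
    have sub: "space S - G \<subseteq> E1 \<union> (\<Union>j\<le>J. E2 j)"
    proof (rule ccontr)
      assume "\<not> ?thesis"
      then obtain \<omega> where \<omega>: "\<omega> \<in> space S" "\<omega> \<notin> G" "\<omega> \<notin> E1" "\<And>j. j \<le> J \<Longrightarrow> \<omega> \<notin> E2 j" by blast
      let ?U = "exp (a * real K)" and ?D = "exp ((g + 2 * a) * real K)"
      have coc: "norm (cocycle n (shift (j * L) \<omega>)) \<le> ?D" if "j \<le> J" "n \<le> J * L" for j n
        using \<omega>(1) \<omega>(4)[of j] that by (auto simp: E2_def K_def)
      have block: "norm (orbit 0 r (shift (j * L) \<omega>)) \<le> ?U" if "j < J" "r \<le> L" for j r
      proof -
        have "j * L + r \<le> K"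
        proof -
          have "j * L + r \<le> Suc j * L" using that by simp
          also have "\<dots> \<le> K" unfolding K_def using that by (intro mult_le_mono1) simp
          finally show ?thesis .
        qed
        have "(\<Sum>i<r. log_size (shift (j * L) \<omega> i))
            \<le> (\<Sum>i<r. real k + max 0 (log_size (\<omega> (j * L + i)) - real k))"
          by (intro sum_mono) (auto simp: shift_def)
        also have "\<dots> = real r * real k + (\<Sum>i<r. max 0 (log_size (\<omega> (j * L + i)) - real k))"
          by (simp add: sum.distrib)
        also have "(\<Sum>i<r. max 0 (log_size (\<omega> (j * L + i)) - real k))
            = (\<Sum>i=j * L..<j * L + r. max 0 (log_size (\<omega> i) - real k))"
          by (rule sum.reindex_bij_witness[of _ "\<lambda>i. i - j * L" "\<lambda>i. j * L + i"]) auto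
        also have "\<dots> \<le> (\<Sum>i<K. max 0 (log_size (\<omega> i) - real k))"
          using \<open>j * L + r \<le> K\<close> by (intro sum_mono2) auto
        also have "\<dots> \<le> a / 2 * real K"
          using \<omega>(1,3) by (auto simp: E1_def)
        also have "real r * real k \<le> real L * (a / 2 * real J)"
          using that kJ by (intro mult_mono) auto
        also have "real L * (a / 2 * real J) + a / 2 * real K = a * real K"
          by (simp add: K_def)
        finally have "(\<Sum>i<r. log_size (shift (j * L) \<omega> i)) \<le> a * real K" by simp
        then have "exp (\<Sum>i<r. log_size (shift (j * L) \<omega> i)) \<le> ?U" by simp
        with norm_orbit_le[of 0 r "shift (j * L) \<omega>"] show ?thesis
          by (simp del: exp_le_cancel_iff)
      qed
      have "stays (exp (b * real K)) K x \<omega>"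
        unfolding stays_def
      proof (intro allI impI)
        fix n assume n: "n \<le> K"
        have "1 \<le> ?D" "1 \<le> ?U"
          using \<open>a > 0\<close> \<open>0 \<le> g\<close> by auto
        then have "?D * 1 \<le> ?D * ?U" "1 * ?U \<le> ?D * ?U"
          by (intro mult_mono; simp)+
        \<comment> \<open>The block recursion starts at 0; the true start contributes only a product
          applied to \<open>x\<close>.\<close>
        have "norm (orbit x n \<omega>) \<le> norm (orbit x n \<omega> - orbit 0 n \<omega>) + norm (orbit 0 n \<omega>)"
          by (metis diff_add_cancel norm_triangle_ineq)
        also have "norm (orbit x n \<omega> - orbit 0 n \<omega>) \<le> ?D * norm x"
          unfolding orbit_diff using coc[of 0 n] n
          by (intro order_trans[OF norm_matrix_vector_mult_le]) (auto simp: K_def intro: mult_right_mono)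
        also have "norm (orbit 0 n \<omega>) \<le> real J * (?D * ?U) + ?U"
          using orbit_le_if_blocks_le[OF block coc, where j = J and s = 0 and n = n] n by (simp add: K_def)
        also have "?D * norm x + (real J * (?D * ?U) + ?U)
            \<le> (?D * ?U) * norm x + (real J * (?D * ?U) + ?D * ?U)"
          using \<open>?D * 1 \<le> ?D * ?U\<close> \<open>1 * ?U \<le> ?D * ?U\<close>
          by (intro add_mono mult_right_mono order_refl) auto
        also have "\<dots> = (real J + 1 + norm x) * (?D * ?U)"
          by (simp add: algebra_simps)
        also have "\<dots> \<le> exp (a * real K) * (?D * ?U)"
          using elim(2) by (intro mult_right_mono) (auto simp: K_def)
        also have "\<dots> = exp (a * real K + ((g + 2 * a) * real K + a * real K))"
          unfolding exp_add ..
        also have "a * real K + ((g + 2 * a) * real K + a * real K) = b * real K"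
          by (simp add: a_def field_simps)
        finally show "norm (orbit x n \<omega>) \<le> exp (b * real K)" by simp
      qed
      with \<omega>(1,2) show False by (simp add: G_def)
    qed
    have "1 - P.prob G = P.prob (space S - G)"
      by (simp add: P.prob_compl)
    also have "\<dots> \<le> P.prob (E1 \<union> (\<Union>j\<le>J. E2 j))"
      by (rule P.finite_measure_mono[OF sub]) measurable
    also have "\<dots> \<le> P.prob E1 + P.prob (\<Union>j\<le>J. E2 j)"
      by (rule measure_Un_le) measurable
    also have "P.prob (\<Union>j\<le>J. E2 j) \<le> (\<Sum>j\<le>J. P.prob (E2 j))"
      by (rule measure_UNION_le) auto
    also have "\<dots> = (\<Sum>j\<le>J. 1 - p K)"
    proof (rule sum.cong[OF refl])
      fix j
      have "P.prob (E2 j) = P.prob {\<omega> \<in> space S. \<not> (\<forall>n\<le>K. norm (cocycle n \<omega>) \<le> exp ((g + 2 * a) * real K))}"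
        unfolding E2_def by (rule prob_shift) measurable
      also have "\<dots> = 1 - p K"
        unfolding p_def by (rule P.prob_neg) measurable
      finally show "P.prob (E2 j) = 1 - p K" .
    qed
    also have "\<dots> = (real J + 1) * (1 - p K)" by simp
    also have "\<dots> \<le> \<delta>" using elim(1) by (simp add: K_def)
    also have "P.prob E1 \<le> (\<integral>\<omega>. max 0 (log_size (\<omega> 0) - real k) \<partial>S) / (a / 2)"
      unfolding E1_def using \<open>a > 0\<close> \<open>0 < K\<close> by (intro prob_sum_excess_ge_le int) auto
    also have "\<dots> \<le> \<delta>"
      using k \<open>a > 0\<close> by (simp add: divide_le_eq)
    finally show ?case by (simp add: \<delta>_def G_def K_def field_simps)
  qed
  with \<open>0 < J\<close> show thesis by (rule that)
qed

lemma suminf_prob_stays_ge: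
  assumes growth_le: "\<And>b. g < b \<Longrightarrow> AE \<omega> in S. \<forall>\<^sub>F n in sequentially. norm (cocycle n \<omega>) \<le> exp (b * real n)"
    and int: "integrable S (\<lambda>\<omega>. log_size (\<omega> 0))"
    and "0 \<le> g" "g < b" "0 \<le> q" "q < 1"
  obtains J :: nat where "\<forall>\<^sub>F R in at_top.
    ennreal ((ln R / b - real J) * q) \<le> (\<Sum>n. ennreal (P.prob {\<omega> \<in> space S. stays R n x \<omega>}))"
proof -
  obtain J where "0 < J" and J: "\<forall>\<^sub>F L in sequentially.
    q \<le> P.prob {\<omega> \<in> space S. stays (exp (b * real (J * L))) (J * L) x \<omega>}"
    by (rule prob_stays_ge[OF growth_le int \<open>0 \<le> g\<close> \<open>g < b\<close> \<open>q < 1\<close>])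
  have "0 < b" using assms by simp
  \<comment> \<open>The largest block length with \<open>exp (b * J * l)\<close> at most
    \<open>R\<close>. The first \<open>J * l\<close> tail probabilities are then at least
    \<open>q\<close>, and rounding to a multiple of \<open>J\<close> loses at most \<open>J\<close>
    of them.\<close>
  define l where "l R = nat \<lfloor>ln R / (b * real J)\<rfloor>" for R :: real
  have "filterlim (\<lambda>R::real. ln R / (b * real J)) at_top at_top"
    using \<open>0 < b\<close> \<open>0 < J\<close>
    by (simp only: divide_inverse)
       (intro filterlim_at_top_mult_tendsto_pos[OF tendsto_const _ ln_at_top], simp)
  then have "filterlim l sequentially at_top"
    unfolding l_def[abs_def]
    by (intro filterlim_compose[OF filterlim_nat_sequentially] filterlim_compose[OF filterlim_floor_sequentially])
  with J have ev: "\<forall>\<^sub>F R in at_top. q \<le> P.prob {\<omega> \<in> space S. stays (exp (b * real (J * l R))) (J * l R) x \<omega>}"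
    by (rule eventually_compose_filterlim)
  have "\<forall>\<^sub>F R in at_top.
    ennreal ((ln R / b - real J) * q) \<le> (\<Sum>n. ennreal (P.prob {\<omega> \<in> space S. stays R n x \<omega>}))"
    using ev eventually_ge_at_top[of 1]
  proof eventually_elim
    case (elim R)
    let ?N = "J * l R"
    have nn: "0 \<le> ln R / (b * real J)" using elim \<open>0 < b\<close> by simp
    then have l: "real (l R) \<le> ln R / (b * real J)" "ln R / (b * real J) - 1 \<le> real (l R)"
      unfolding l_def by linarith+
    have "real (l R) * (b * real J) \<le> ln R"
      using l(1) \<open>0 < b\<close> \<open>0 < J\<close> by (simp add: le_divide_eq)
    then have "exp (b * real ?N) \<le> exp (ln R)"
      by (simp add: mult_ac)
    then have le_R: "exp (b * real ?N) \<le> R" using elim by simp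
    have "ln R / b - real J = real J * (ln R / (b * real J) - 1)"
      using \<open>0 < J\<close> \<open>0 < b\<close> by (simp add: field_simps)
    also have "\<dots> \<le> real ?N"
      using l(2) by (simp add: mult_left_mono)
    finally have "ennreal ((ln R / b - real J) * q) \<le> ennreal (real ?N * q)"
      using \<open>0 \<le> q\<close> by (intro ennreal_leI mult_right_mono)
    also have "\<dots> = (\<Sum>n<?N. ennreal q)"
      by (simp add: ennreal_mult' ennreal_of_nat_eq_real_of_nat)
    also have "\<dots> \<le> (\<Sum>n<?N. ennreal (P.prob {\<omega> \<in> space S. stays R n x \<omega>}))"
    proof (intro sum_mono ennreal_leI)
      fix n assume "n \<in> {..<?N}"
      then have "P.prob {\<omega> \<in> space S. stays (exp (b * real ?N)) ?N x \<omega>}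
          \<le> P.prob {\<omega> \<in> space S. stays R n x \<omega>}"
        using le_R by (intro P.finite_measure_mono) (auto simp: stays_def simp del: of_nat_mult intro!: order_trans[OF _ le_R])
      with elim(1) show "q \<le> P.prob {\<omega> \<in> space S. stays R n x \<omega>}" by simp
    qed
    also have "\<dots> \<le> (\<Sum>n. ennreal (P.prob {\<omega> \<in> space S. stays R n x \<omega>}))"
      by (rule sum_le_suminf) auto
    finally show ?case .
  qed
  then show thesis by (rule that)
qed

end

section \<open>Tail sums, logarithmic moments and exponential rates\<close>

text \<open>Pointwise form of the tail sum formula: the summand is 1 exactly while the first hit
  lies strictly after \<open>n\<close>, and forever if there is no hit.\<close>

lemma ennreal_of_enat_INF_eq_suminf:
  "ennreal_of_enat (INF n\<in>{n. P n}. enat n) = (\<Sum>n. if \<forall>k\<le>n. \<not> P k then 1 else 0)"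
proof (cases "\<exists>n. P n")
  case False
  then have "(\<Sum>n. if \<forall>k\<le>n. \<not> P k then 1 else (0::ennreal)) = (\<Sum>n. 1)"
    by simp
  also have "\<dots> = top"
    by (simp add: suminf_eq_SUP ennreal_SUP_of_nat_eq_top)
  finally show ?thesis using False by (simp add: top_enat_def)
next
  case True
  define m where "m = (LEAST n. P n)"
  have "P m" unfolding m_def using True by (rule LeastI_ex)
  have less: "\<not> P k" if "k < m" for k
    using that unfolding m_def by (rule not_less_Least)
  have "(INF n\<in>{n. P n}. enat n) = enat m"
    using \<open>P m\<close> less by (intro antisym INF_lower INF_greatest) (auto simp: not_less[symmetric])
  moreover have "(\<Sum>n. if \<forall>k\<le>n. \<not> P k then 1 else (0::ennreal)) = (\<Sum>n<m. 1)"
  proof (subst suminf_finite[of "{..<m}"])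
    show "(\<Sum>n<m. if \<forall>k\<le>n. \<not> P k then 1 else (0::ennreal)) = (\<Sum>n<m. 1)"
      using less by (intro sum.cong) auto
  qed (use \<open>P m\<close> in \<open>auto simp: not_less\<close>)
  ultimately show ?thesis by simp
qed

lemma affine_process_eq_orbit:
  "affine_process As Bs x n \<omega> = orbit x n (\<lambda>i. (As (Suc i) \<omega>, Bs (Suc i) \<omega>))"
  by (induction n) auto

lemma left_product_eq_cocycle:
  "left_product As n \<omega> = cocycle n (\<lambda>i. (As (Suc i) \<omega>, Bs (Suc i) \<omega>))"
  by (induction n) auto

lemma ln_1_plus_sum_le:
  fixes f :: "'a \<Rightarrow> real"
  assumes "\<And>i. i \<in> I \<Longrightarrow> 0 \<le> f i"
  shows "ln (1 + (\<Sum>i\<in>I. f i)) \<le> (\<Sum>i\<in>I. ln (1 + f i))"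
  using assms
proof (induction I rule: infinite_finite_induct)
  case (insert i I)
  have nn: "0 \<le> (\<Sum>i\<in>I. f i)" "0 \<le> f i"
    using insert.prems by (auto intro: sum_nonneg)
  have "ln (1 + (f i + (\<Sum>i\<in>I. f i))) \<le> ln ((1 + f i) * (1 + (\<Sum>i\<in>I. f i)))"
    using nn by (intro ln_mono) (auto simp: algebra_simps)
  also have "\<dots> = ln (1 + f i) + ln (1 + (\<Sum>i\<in>I. f i))"
    using nn by (simp add: ln_mult)
  finally show ?case using insert by simp
qed auto

text \<open>The mean of the logarithm is at most the sum over \<open>n\<close> of the probabilities
  that it exceeds \<open>n\<close>. By the tail bound these are of order \<open>n\<close> to the
  power -\<beta>, which is summable for \<beta> above 1.\<close>

lemma (in prob_space) integrable_ln_1_plus_if_tail_le: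
  assumes u [measurable]: "random_variable borel u" and nonneg: "\<And>\<omega>. 0 \<le> u \<omega>"
    and "1 < \<beta>" "0 \<le> C" "0 < R"
    and tail: "\<And>z. z\<^sub>0 \<le> z \<Longrightarrow> prob {\<omega> \<in> space M. z * R < u \<omega>} \<le> C / (ln z) powr \<beta>"
  shows "integrable M (\<lambda>\<omega>. ln (1 + u \<omega>) :: real)"
proof (rule integrableI_nonneg)
  let ?h = "\<lambda>\<omega>. ln (1 + u \<omega>)"
  show [measurable]: "random_variable borel ?h" by measurable
  show "AE \<omega> in M. 0 \<le> ?h \<omega>" using nonneg by simp
  define p where "p n = prob {\<omega> \<in> space M. real n < ?h \<omega>}" for n
  have ptwise: "ennreal (?h \<omega>) \<le> (\<Sum>n. indicator {\<omega> \<in> space M. real n < ?h \<omega>} \<omega>)" if "\<omega> \<in> space M" for \<omega>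
  proof -
    have "?h \<omega> \<le> real (nat \<lceil>?h \<omega>\<rceil>)" by linarith
    then have "ennreal (?h \<omega>) \<le> ennreal (real (nat \<lceil>?h \<omega>\<rceil>))" by (rule ennreal_leI)
    also have "\<dots> = (\<Sum>n<nat \<lceil>?h \<omega>\<rceil>. 1)" by (simp add: ennreal_of_nat_eq_real_of_nat)
    also have "\<dots> = (\<Sum>n<nat \<lceil>?h \<omega>\<rceil>. indicator {\<omega> \<in> space M. real n < ?h \<omega>} \<omega>)"
    proof (rule sum.cong[OF refl])
      fix n assume "n \<in> {..<nat \<lceil>?h \<omega>\<rceil>}"
      then have "real n < ?h \<omega>" by simp linarith
      with that show "(1::ennreal) = indicator {\<omega> \<in> space M. real n < ?h \<omega>} \<omega>" by simp
    qed
    also have "\<dots> \<le> (\<Sum>n. indicator {\<omega> \<in> space M. real n < ?h \<omega>} \<omega>)"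
      by (rule sum_le_suminf) auto
    finally show ?thesis .
  qed
  have "(\<integral>\<^sup>+\<omega>. ennreal (?h \<omega>) \<partial>M) \<le> (\<integral>\<^sup>+\<omega>. (\<Sum>n. indicator {\<omega> \<in> space M. real n < ?h \<omega>} \<omega>) \<partial>M)"
    by (intro nn_integral_mono ptwise)
  also have "\<dots> = (\<Sum>n. ennreal (p n))"
    by (subst nn_integral_suminf) (auto simp: p_def emeasure_eq_measure)
  also have "\<dots> < \<infinity>"
  proof -
    have ev: "\<forall>\<^sub>F n in sequentially. Z \<le> exp (real n / 2)" for Z
      using filterlim_exp_mult_real[of "1/2"] by (simp add: filterlim_at_top)
    have "\<forall>\<^sub>F n in sequentially. norm (p n) \<le> (C * 2 powr \<beta>) * real n powr (- \<beta>)"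
      using ev[of z\<^sub>0] ev[of "R + 1"] eventually_gt_at_top[of 0]
    proof eventually_elim
      case (elim n)
      \<comment> \<open>Half of the exponent is spent on absorbing \<open>R\<close> and the 1 inside
        the logarithm; the other half stays in the tail bound and costs only the constant
        \<open>2 powr \<beta>\<close>.\<close>
      let ?z = "exp (real n / 2)"
      have "?z * R + 1 \<le> ?z * ?z"
      proof -
        have "?z * R + 1 \<le> ?z * R + ?z" by simp
        also have "\<dots> = ?z * (R + 1)" by (simp add: algebra_simps)
        also have "\<dots> \<le> ?z * ?z" using elim by (intro mult_left_mono) auto
        finally show ?thesis .
      qed
      also have "?z * ?z = exp (real n)" by (simp add: exp_add[symmetric])
      finally have z: "?z * R + 1 \<le> exp (real n)" .
      have "p n \<le> prob {\<omega> \<in> space M. ?z * R < u \<omega>}"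
        unfolding p_def
      proof (rule finite_measure_mono)
        show "{\<omega> \<in> space M. real n < ?h \<omega>} \<subseteq> {\<omega> \<in> space M. ?z * R < u \<omega>}"
        proof safe
          fix \<omega> assume "real n < ?h \<omega>"
          then have "exp (real n) < 1 + u \<omega>"
            using nonneg[of \<omega>] by (metis add_pos_nonneg exp_less_cancel_iff exp_ln zero_less_one)
          then show "?z * R < u \<omega>" using z by simp
        qed
      qed measurable
      also have "\<dots> \<le> C / (ln ?z) powr \<beta>" by (rule tail) (rule elim)
      also have "\<dots> = (C * 2 powr \<beta>) * real n powr (- \<beta>)"
        using elim by (simp add: powr_divide powr_minus field_simps)
      finally show ?case by (simp add: p_def)
    qed
    then have "summable p"
      by (rule summable_comparison_test_ev)
         (use \<open>1 < \<beta>\<close> in \<open>auto intro!: summable_mult simp: summable_real_powr_iff\<close>)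
    then have "(\<Sum>n. ennreal (p n)) \<noteq> top"
      by (rule ennreal_suminf_neq_top) (simp add: p_def)
    then show ?thesis by (simp only: infinity_ennreal_def less_top)
  qed
  finally show "(\<integral>\<^sup>+\<omega>. ennreal (?h \<omega>) \<partial>M) < \<infinity>" .
qed

lemma eventually_exp_le_norm_if_elog_tendsto:
  fixes P :: "nat \<Rightarrow> real^'n^'n"
  assumes lim: "(\<lambda>n. elog (onorm ((*v) (P n))) / ereal (real n)) \<longlonglongrightarrow> \<gamma>" and c: "ereal c < \<gamma>"
  shows "\<forall>\<^sub>F n in sequentially. exp (c * real n) \<le> norm (P n)"
  using order_tendstoD(1)[OF lim c] eventually_gt_at_top[of 0]
proof eventually_elim
  case (elim n)
  let ?r = "onorm ((*v) (P n))"
  have r: "0 \<le> ?r" by (rule onorm_pos_le) simp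
  \<comment> \<open>At norm 0 the quotient is minus infinity and could not exceed
    \<open>c\<close>.\<close>
  have "?r \<noteq> 0" using elim by (auto simp: elog_def)
  with r elim have "c * real n < ln ?r"
    by (simp add: elog_def pos_less_divide_eq)
  then have "exp (c * real n) < ?r"
    using r \<open>?r \<noteq> 0\<close> by (metis exp_less_cancel_iff exp_ln less_eq_real_def)
  also have "\<dots> \<le> norm (P n)" by (rule onorm_le_norm_matrix)
  finally show ?case by simp
qed

lemma eventually_norm_le_exp_if_elog_tendsto:
  fixes P :: "nat \<Rightarrow> real^'n^'n"
  assumes lim: "(\<lambda>n. elog (onorm ((*v) (P n))) / ereal (real n)) \<longlonglongrightarrow> ereal g" and "g < b"
  shows "\<forall>\<^sub>F n in sequentially. norm (P n) \<le> exp (b * real n)"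
proof -
  \<comment> \<open>The gap between the intermediate rate and \<open>b\<close> absorbs the
    dimensional constant of the norm comparison.\<close>
  define a where "a = (g + b) / 2"
  define C where "C = real CARD('n) * real CARD('n)"
  have "ereal g < ereal a" "0 < b - a" using \<open>g < b\<close> by (simp_all add: a_def)
  have "filterlim (\<lambda>n. exp ((b - a) * real n)) at_top sequentially"
    by (rule filterlim_exp_mult_real[OF \<open>0 < b - a\<close>])
  then have "\<forall>\<^sub>F n in sequentially. C \<le> exp ((b - a) * real n)"
    by (simp add: filterlim_at_top)
  with order_tendstoD(2)[OF lim \<open>ereal g < ereal a\<close>] eventually_gt_at_top[of 0] show ?thesis
  proof eventually_elim
    case (elim n)
    let ?r = "onorm ((*v) (P n))"
    have r: "0 \<le> ?r" by (rule onorm_pos_le) simp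
    have "?r \<le> exp (a * real n)"
    proof (cases "?r = 0")
      case False
      with r elim have "ln ?r < a * real n"
        by (simp add: elog_def pos_divide_less_eq)
      then show ?thesis
        using r False by (metis exp_le_cancel_iff exp_ln less_eq_real_def)
    qed simp
    have "norm (P n) \<le> C * ?r"
      unfolding C_def by (rule norm_matrix_le_onorm)
    also have "\<dots> \<le> exp ((b - a) * real n) * exp (a * real n)"
      using elim \<open>?r \<le> exp (a * real n)\<close> r by (intro mult_mono) auto
    also have "\<dots> = exp (b * real n)"
      by (simp add: exp_add[symmetric] algebra_simps)
    finally show ?case .
  qed
qed

section \<open>Transfer between the given probability space and the product space\<close>

locale affine_recursion = prob_space M
  for M :: "'a measure" +
  fixes A :: "'a \<Rightarrow> real^'n^'n" and B :: "'a \<Rightarrow> real^'n"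
    and As :: "nat \<Rightarrow> 'a \<Rightarrow> real^'n^'n" and Bs :: "nat \<Rightarrow> 'a \<Rightarrow> real^'n"
  assumes measurable_A [measurable]: "A \<in> borel_measurable M"
    and measurable_B [measurable]: "B \<in> borel_measurable M"
    and iid: "iid_copies M (\<lambda>\<omega>. (A \<omega>, B \<omega>)) (\<lambda>n \<omega>. (As n \<omega>, Bs n \<omega>))"
begin

definition law :: "'n affine_map measure" where
  "law = distr M borel (\<lambda>\<omega>. (A \<omega>, B \<omega>))"

definition environment :: "'a \<Rightarrow> nat \<Rightarrow> 'n affine_map" where
  "environment \<omega> = (\<lambda>i. (As (Suc i) \<omega>, Bs (Suc i) \<omega>))"

lemma measurable_pair [measurable]: "(\<lambda>\<omega>. (A \<omega>, B \<omega>)) \<in> borel_measurable M"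
  by (rule borel_measurable_Pair) measurable

lemma sets_law [simp, measurable_cong]: "sets law = sets borel"
  by (simp add: law_def)

lemma prob_space_law: "prob_space law"
  unfolding law_def by (rule prob_space_distr) measurable

sublocale env: iid_affine law
proof -
  interpret law: prob_space law by (rule prob_space_law)
  interpret product_prob_space "\<lambda>i. law" "UNIV :: nat set" ..
  show "iid_affine law"
    by unfold_locales (rule sets_law)
qed

lemma indep: "indep_vars (\<lambda>_. borel) (\<lambda>n \<omega>. (As n \<omega>, Bs n \<omega>)) {1..}"
  and distr_copy: "1 \<le> n \<Longrightarrow> distr M borel (\<lambda>\<omega>. (As n \<omega>, Bs n \<omega>)) = law"
  using iid by (auto simp: iid_copies_def law_def)

lemma measurable_copy [measurable]: "1 \<le> n \<Longrightarrow> (\<lambda>\<omega>. (As n \<omega>, Bs n \<omega>)) \<in> M \<rightarrow>\<^sub>M borel"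
  using indep by (auto simp: indep_vars_def2)

lemma measurable_environment [measurable]: "environment \<in> M \<rightarrow>\<^sub>M env.S"
  unfolding environment_def[abs_def]
proof (rule measurable_PiM_single')
  fix i :: nat
  have "(\<lambda>\<omega>. (As (Suc i) \<omega>, Bs (Suc i) \<omega>)) \<in> M \<rightarrow>\<^sub>M borel" by (rule measurable_copy) simp
  then show "(\<lambda>\<omega>. (As (Suc i) \<omega>, Bs (Suc i) \<omega>)) \<in> M \<rightarrow>\<^sub>M law"
    by (simp cong: measurable_cong_sets)
qed (simp add: law_def)

text \<open>Independence makes the joint law of the copies a product over the indices from 1 on;
  reindexing by \<open>Suc\<close> gives the product over all naturals.\<close>

lemma distr_environment: "distr M env.S environment = env.S"
proof -
  let ?I = "{1..} :: nat set"
  let ?Z = "\<lambda>x. \<lambda>i\<in>?I. (As i x, Bs i x)"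
  let ?P = "Pi\<^sub>M ?I (\<lambda>_. law)"
  have "distr M (Pi\<^sub>M ?I (\<lambda>_. borel)) ?Z = Pi\<^sub>M ?I (\<lambda>i. distr M borel (\<lambda>\<omega>. (As i \<omega>, Bs i \<omega>)))"
    using indep by (subst (asm) indep_vars_iff_distr_eq_PiM') (auto intro!: measurable_copy)
  also have "\<dots> = ?P"
    by (rule PiM_cong) (simp_all add: distr_copy)
  also have "distr M (Pi\<^sub>M ?I (\<lambda>_. borel)) ?Z = distr M ?P ?Z"
    by (rule distr_cong) (auto intro!: sets_PiM_cong)
  finally have Z: "distr M ?P ?Z = ?P" .
  have Zm: "?Z \<in> M \<rightarrow>\<^sub>M ?P"
  proof (rule measurable_restrict)
    fix i assume "i \<in> ?I"
    then have "(\<lambda>\<omega>. (As i \<omega>, Bs i \<omega>)) \<in> M \<rightarrow>\<^sub>M borel" by (intro measurable_copy) simp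
    then show "(\<lambda>\<omega>. (As i \<omega>, Bs i \<omega>)) \<in> M \<rightarrow>\<^sub>M law"
      by (simp cong: measurable_cong_sets)
  qed
  have re: "(\<lambda>\<omega>. \<lambda>n\<in>UNIV. \<omega> (Suc n)) \<in> ?P \<rightarrow>\<^sub>M env.S"
    by (rule measurable_restrict) (rule measurable_component_singleton, simp)
  have "env.S = distr ?P env.S (\<lambda>\<omega>. \<lambda>n\<in>UNIV. \<omega> (Suc n))"
    using distr_PiM_reindex[of ?I "\<lambda>_. law" Suc UNIV] prob_space_law by (auto simp: Pi_iff)
  also have "\<dots> = distr (distr M ?P ?Z) env.S (\<lambda>\<omega>. \<lambda>n\<in>UNIV. \<omega> (Suc n))"
    by (simp only: Z)
  also have "\<dots> = distr M env.S ((\<lambda>\<omega>. \<lambda>n\<in>UNIV. \<omega> (Suc n)) \<circ> ?Z)"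
    by (rule distr_distr[OF re Zm])
  also have "\<dots> = distr M env.S environment"
    by (rule distr_cong) (auto simp: environment_def comp_def)
  finally show ?thesis ..
qed

lemma AE_environment_iff:
  assumes [measurable]: "Measurable.pred env.S P"
  shows "(AE \<omega> in env.S. P \<omega>) \<longleftrightarrow> (AE \<omega> in M. P (environment \<omega>))"
  by (subst distr_environment[symmetric], rule AE_distr_iff) auto

lemma distr_coordinate_0: "distr env.S law (\<lambda>\<omega>. \<omega> 0) = distr M law (\<lambda>\<omega>. (A \<omega>, B \<omega>))"
proof -
  have "distr env.S law (\<lambda>\<omega>. \<omega> 0) = law"
    by (rule distr_PiM_component) (simp_all add: prob_space_law)
  also have "\<dots> = distr M law (\<lambda>\<omega>. (A \<omega>, B \<omega>))"
    unfolding law_def by (rule distr_cong) simp_all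
  finally show ?thesis .
qed

lemma measurable_pair_law: "(\<lambda>\<omega>. (A \<omega>, B \<omega>)) \<in> M \<rightarrow>\<^sub>M law"
  using measurable_pair by (simp cong: measurable_cong_sets)

lemma AE_coordinate_0_iff:
  assumes "Measurable.pred borel P"
  shows "(AE \<omega> in env.S. P (\<omega> 0)) \<longleftrightarrow> (AE \<omega> in M. P (A \<omega>, B \<omega>))"
proof -
  have P: "{a \<in> space law. P a} \<in> sets law"
    using assms by (simp add: pred_def law_def)
  have "(AE \<omega> in env.S. P (\<omega> 0)) \<longleftrightarrow> (AE a in distr env.S law (\<lambda>\<omega>. \<omega> 0). P a)"
    by (rule AE_distr_iff[OF env.measurable_coordinate P, symmetric])
  also have "\<dots> \<longleftrightarrow> (AE \<omega> in M. P (A \<omega>, B \<omega>))"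
    unfolding distr_coordinate_0 by (rule AE_distr_iff[OF measurable_pair_law P])
  finally show ?thesis .
qed

lemma integrable_coordinate_0_iff:
  fixes f :: "'n affine_map \<Rightarrow> real"
  assumes "f \<in> borel_measurable borel"
  shows "integrable env.S (\<lambda>\<omega>. f (\<omega> 0)) \<longleftrightarrow> integrable M (\<lambda>\<omega>. f (A \<omega>, B \<omega>))"
proof -
  have f: "f \<in> borel_measurable law"
    using assms by (simp cong: measurable_cong_sets)
  have "integrable env.S (\<lambda>\<omega>. f (\<omega> 0)) \<longleftrightarrow> integrable (distr env.S law (\<lambda>\<omega>. \<omega> 0)) f"
    by (rule integrable_distr_eq[OF env.measurable_coordinate f, symmetric])
  also have "\<dots> \<longleftrightarrow> integrable M (\<lambda>\<omega>. f (A \<omega>, B \<omega>))"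
    unfolding distr_coordinate_0 by (rule integrable_distr_eq[OF measurable_pair_law f])
  finally show ?thesis .
qed

lemma expected_exit_time_eq:
  "expected_exit_time M As Bs R x = (\<Sum>n. ennreal (env.P.prob {\<omega> \<in> space env.S. stays R n x \<omega>}))"
proof -
  have eq: "ennreal_of_enat (exit_time As Bs R x \<omega>)
      = (\<Sum>n. indicator {\<omega> \<in> space M. stays R n x (environment \<omega>)} \<omega>)" if "\<omega> \<in> space M" for \<omega>
    unfolding exit_time_def ennreal_of_enat_INF_eq_suminf
    using that by (intro suminf_cong)
      (auto simp: stays_def affine_process_eq_orbit environment_def not_less)
  have [measurable]: "Measurable.pred M (\<lambda>\<omega>. stays R n x (environment \<omega>))" for n
    by measurable
  have "expected_exit_time M As Bs R x
      = (\<integral>\<^sup>+\<omega>. (\<Sum>n. indicator {\<omega> \<in> space M. stays R n x (environment \<omega>)} \<omega>) \<partial>M)"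
    unfolding expected_exit_time_def by (rule nn_integral_cong) (rule eq)
  also have "\<dots> = (\<Sum>n. emeasure M {\<omega> \<in> space M. stays R n x (environment \<omega>)})"
    by (subst nn_integral_suminf) auto
  also have "\<dots> = (\<Sum>n. emeasure (distr M env.S environment) {\<omega> \<in> space env.S. stays R n x \<omega>})"
  proof (rule suminf_cong)
    fix n
    have "environment -` {\<omega> \<in> space env.S. stays R n x \<omega>} \<inter> space M = {\<omega> \<in> space M. stays R n x (environment \<omega>)}"
      using measurable_space[OF measurable_environment] by auto
    then show "emeasure M {\<omega> \<in> space M. stays R n x (environment \<omega>)}
        = emeasure (distr M env.S environment) {\<omega> \<in> space env.S. stays R n x \<omega>}"
      by (simp add: emeasure_distr)
  qed
  finally show ?thesis
    by (simp add: distr_environment env.P.emeasure_eq_measure)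
qed

lemma log_growth_eq: "log_growth As n \<omega> = elog (onorm ((*v) (cocycle n (environment \<omega>))))"
  by (simp add: log_growth_def left_product_eq_cocycle[where Bs = Bs] environment_def)

lemma expanding_affine_law:
  assumes lim: "AE \<omega> in M. (\<lambda>n. log_growth As n \<omega> / ereal (real n)) \<longlonglongrightarrow> \<gamma>"
    and irr: "irreducible_matrix M A"
    and disp: "(INF x. ereal_expectation M (\<lambda>\<omega>. elog (norm (A \<omega> *v x + B \<omega> - x)))) > - \<infinity>"
    and "0 < c" "ereal c < \<gamma>"
  shows "expanding_affine law c"
proof
  show "0 < c" by fact
  show "AE \<omega> in env.S. \<forall>\<^sub>F n in sequentially. exp (c * real n) \<le> norm (cocycle n \<omega>)"
  proof (subst AE_environment_iff)
    show "AE \<omega> in M. \<forall>\<^sub>F n in sequentially. exp (c * real n) \<le> norm (cocycle n (environment \<omega>))"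
      using lim
    proof eventually_elim
      case (elim \<omega>)
      then show ?case
        unfolding log_growth_eq
        by (rule eventually_exp_le_norm_if_elog_tendsto) fact
    qed
  qed (rule env.measurable_cocycle_growth)
next
  fix V :: "(real^'n) set"
  assume V: "subspace V" and inv: "AE \<omega> in env.S. (*v) (fst (\<omega> 0)) ` V \<subseteq> V"
  \<comment> \<open>Invariance of \<open>V\<close> becomes finitely many closed conditions, hence a
    Borel event whose probability can be transferred.\<close>
  obtain T where T: "T \<subseteq> V" "finite T" "V \<subseteq> span T"
    using basis_exists[of V] finiteI_independent by metis
  have img: "(*v) G ` V \<subseteq> V \<longleftrightarrow> (\<forall>b\<in>T. G *v b \<in> V)" for G :: "real^'n^'n"
  proof
    assume "\<forall>b\<in>T. G *v b \<in> V"
    then have "span ((*v) G ` T) \<subseteq> V" using V by (intro span_minimal) auto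
    then show "(*v) G ` V \<subseteq> V"
      using T(3) by (auto simp: linear_span_image[OF matrix_vector_mul_linear])
  qed (use T in auto)
  have [measurable]: "Measurable.pred borel (\<lambda>a :: 'n affine_map. fst a *v b \<in> V)" for b
  proof -
    have "closed ((\<lambda>a :: 'n affine_map. fst a *v b) -` V)"
      by (intro closed_vimage closed_subspace V continuous_intros)
    then show ?thesis by (simp add: pred_def vimage_def borel_closed)
  qed
  have "AE \<omega> in env.S. \<forall>b\<in>T. fst (\<omega> 0) *v b \<in> V"
    using inv by (simp add: img)
  then have "AE \<omega> in M. \<forall>b\<in>T. A \<omega> *v b \<in> V"
    using T(2) by (subst (asm) AE_coordinate_0_iff) (auto intro: pred_intros_finite)
  then have "AE \<omega> in M. (*v) (A \<omega>) ` V \<subseteq> V"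
    by (simp add: img)
  with irr V show "V = {0} \<or> V = UNIV"
    unfolding irreducible_matrix_def by blast
next
  fix x
  show "\<not> (AE \<omega> in env.S. fst (\<omega> 0) *v x + snd (\<omega> 0) = x)"
  proof
    assume "AE \<omega> in env.S. fst (\<omega> 0) *v x + snd (\<omega> 0) = x"
    then have "AE \<omega> in M. A \<omega> *v x + B \<omega> = x"
      by (subst (asm) AE_coordinate_0_iff) (auto intro!: borel_closed closed_Collect_eq continuous_intros simp: pred_def)
    \<comment> \<open>At a fixed point the positive part has integral 0 and the negative part
      infinite integral, so the expectation is a genuine minus infinity and contradicts the bound on
      the infimum.\<close>
    then have log: "AE \<omega> in M. elog (norm (A \<omega> *v x + B \<omega> - x)) = - \<infinity>"
      by eventually_elim (simp add: elog_def)
    have "(\<integral>\<^sup>+\<omega>. e2ennreal (elog (norm (A \<omega> *v x + B \<omega> - x))) \<partial>M) = (\<integral>\<^sup>+\<omega>. 0 \<partial>M)"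
      by (rule nn_integral_cong_AE) (use log in \<open>auto simp: e2ennreal_neg\<close>)
    moreover have "(\<integral>\<^sup>+\<omega>. e2ennreal (- elog (norm (A \<omega> *v x + B \<omega> - x))) \<partial>M) = (\<integral>\<^sup>+\<omega>. \<infinity> \<partial>M)"
      by (rule nn_integral_cong_AE) (use log in auto)
    ultimately have "ereal_expectation M (\<lambda>\<omega>. elog (norm (A \<omega> *v x + B \<omega> - x))) = - \<infinity>"
      by (simp add: ereal_expectation_def emeasure_space_1 zero_ennreal.rep_eq)
    moreover have "(INF x. ereal_expectation M (\<lambda>\<omega>. elog (norm (A \<omega> *v x + B \<omega> - x))))
        \<le> ereal_expectation M (\<lambda>\<omega>. elog (norm (A \<omega> *v x + B \<omega> - x)))"
      by (rule INF_lower) simp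
    ultimately show False using disp by simp
  qed
qed

text \<open>The tail condition is evaluated at finitely many points: \<open>x = 0\<close> controls
  \<open>B\<close>, and the multiples of the basis vectors of norm \<open>R\<close> control the
  columns of \<open>A\<close> once \<open>B\<close> is subtracted. Subadditivity of
  \<open>ln (1 + _)\<close> on nonnegative reals combines these bounds.\<close>

lemma integrable_log_size:
  assumes tail: "\<And>z x. z\<^sub>0 \<le> z \<Longrightarrow> norm x \<le> R \<Longrightarrow>
      prob {\<omega> \<in> space M. z * R < norm (A \<omega> *v x + B \<omega>)} \<le> C / (ln z) powr \<beta>"
    and "1 < \<beta>" "0 \<le> C" "1 \<le> R"
  shows "integrable env.S (\<lambda>\<omega>. log_size (\<omega> 0))"
proof -
  have int: "integrable M (\<lambda>\<omega>. ln (1 + norm (A \<omega> *v x + B \<omega>)))" if "norm x \<le> R" for x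
    using assms that by (intro integrable_ln_1_plus_if_tail_le[where R = R and z\<^sub>0 = z\<^sub>0 and C = C and \<beta> = \<beta>]) auto
  define u where "u j \<omega> = norm (A \<omega> *v (R *\<^sub>R axis j 1) + B \<omega>)" for j \<omega>
  define F where "F \<omega> = (\<Sum>(i, j)\<in>(UNIV :: ('n \<times> 'n) set). ln (1 + u j \<omega>) + ln (1 + norm (B \<omega>))) + ln (1 + norm (B \<omega>))" for \<omega>
  have intB: "integrable M (\<lambda>\<omega>. ln (1 + norm (B \<omega>)))"
    using int[of 0] \<open>1 \<le> R\<close> by simp
  have intu: "integrable M (\<lambda>\<omega>. ln (1 + u j \<omega>))" for j
    unfolding u_def using \<open>1 \<le> R\<close> by (intro int) simp
  have "integrable M F"
    unfolding F_def[abs_def] split_def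
    by (intro Bochner_Integration.integrable_add Bochner_Integration.integrable_sum intB intu)
  have ln_add: "ln (1 + (a + b)) \<le> ln (1 + a) + ln (1 + b)" if "0 \<le> a" "0 \<le> b" for a b :: real
    using ln_1_plus_sum_le[of "{True, False}" "\<lambda>t. if t then a else b"] that by simp
  have bound: "log_size (A \<omega>, B \<omega>) \<le> F \<omega>" for \<omega>
  proof -
    have comp: "\<bar>A \<omega> $ i $ j\<bar> \<le> u j \<omega> + norm (B \<omega>)" for i j
    proof -
      have "\<bar>A \<omega> $ i $ j\<bar> = \<bar>(A \<omega> *v axis j 1) $ i\<bar>"
        by (simp add: matrix_vector_mult_basis column_def)
      also have "\<dots> \<le> norm (A \<omega> *v axis j 1)"
        by (rule component_le_norm_cart)
      also have "\<dots> \<le> R * norm (A \<omega> *v axis j 1)"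
        using mult_right_mono[OF \<open>1 \<le> R\<close>, of "norm (A \<omega> *v axis j 1)"] by simp
      also have "\<dots> = norm (A \<omega> *v (R *\<^sub>R axis j 1))"
        using \<open>1 \<le> R\<close> by (simp add: linear_scale[OF matrix_vector_mul_linear])
      also have "\<dots> \<le> u j \<omega> + norm (B \<omega>)"
        unfolding u_def by (metis add_diff_cancel_right' norm_triangle_ineq4)
      finally show ?thesis .
    qed
    have "norm (A \<omega>) \<le> (\<Sum>i\<in>UNIV. norm (A \<omega> $ i))"
      unfolding norm_vec_def[of "A \<omega>"] by (rule L2_set_le_sum) simp
    also have "\<dots> \<le> (\<Sum>i\<in>UNIV. \<Sum>j\<in>UNIV. \<bar>A \<omega> $ i $ j\<bar>)"
      by (intro sum_mono norm_le_l1_cart)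
    also have "\<dots> = (\<Sum>(i, j)\<in>UNIV. \<bar>A \<omega> $ i $ j\<bar>)"
      by (simp add: sum.cartesian_product)
    finally have "log_size (A \<omega>, B \<omega>) \<le> ln (1 + ((\<Sum>(i, j)\<in>UNIV. \<bar>A \<omega> $ i $ j\<bar>) + norm (B \<omega>)))"
      unfolding log_size_def by (intro ln_mono) (auto simp: add_pos_nonneg)
    also have "\<dots> \<le> ln (1 + (\<Sum>(i, j)\<in>UNIV. \<bar>A \<omega> $ i $ j\<bar>)) + ln (1 + norm (B \<omega>))"
      by (intro ln_add sum_nonneg) auto
    also have "ln (1 + (\<Sum>(i, j)\<in>UNIV. \<bar>A \<omega> $ i $ j\<bar>)) \<le> (\<Sum>(i, j)\<in>UNIV. ln (1 + \<bar>A \<omega> $ i $ j\<bar>))"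
      using ln_1_plus_sum_le[of UNIV "\<lambda>(i, j). \<bar>A \<omega> $ i $ j\<bar>"] by (simp add: split_def)
    also have "\<dots> \<le> (\<Sum>(i, j)\<in>(UNIV :: ('n \<times> 'n) set). ln (1 + u j \<omega>) + ln (1 + norm (B \<omega>)))"
    proof (intro sum_mono, safe)
      fix i j :: 'n
      have "ln (1 + \<bar>A \<omega> $ i $ j\<bar>) \<le> ln (1 + (u j \<omega> + norm (B \<omega>)))"
        using comp[of i j] by (intro ln_mono) auto
      also have "\<dots> \<le> ln (1 + u j \<omega>) + ln (1 + norm (B \<omega>))"
        by (rule ln_add) (auto simp: u_def)
      finally show "ln (1 + \<bar>A \<omega> $ i $ j\<bar>) \<le> ln (1 + u j \<omega>) + ln (1 + norm (B \<omega>))" .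
    qed
    finally show ?thesis by (simp add: F_def)
  qed
  have ls [measurable]: "log_size \<in> borel_measurable (borel :: 'n affine_map measure)"
    unfolding log_size_def[abs_def]
    by (intro borel_measurable_ln borel_measurable_continuous_onI continuous_intros)
  have "integrable M (\<lambda>\<omega>. log_size (A \<omega>, B \<omega>))"
  proof (rule Bochner_Integration.integrable_bound[OF \<open>integrable M F\<close>])
    have "\<bar>log_size (A \<omega>, B \<omega>)\<bar> \<le> \<bar>F \<omega>\<bar>" for \<omega>
      using bound[of \<omega>] log_size_nonneg[of "(A \<omega>, B \<omega>)"] by linarith
    then show "AE \<omega> in M. norm (log_size (A \<omega>, B \<omega>)) \<le> norm (F \<omega>)"
      by simp
  qed measurable
  then show ?thesis by (simp add: integrable_coordinate_0_iff[OF ls])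
qed

lemma Limsup_exit_time_less_infinity:
  assumes "expanding_affine law c"
  shows "Limsup at_top (\<lambda>R. enn2ereal (expected_exit_time M As Bs R x) / ereal (ln R)) < \<infinity>"
proof -
  interpret expanding_affine law c by fact
  obtain K L where KL: "\<And>R x. 1 \<le> R \<Longrightarrow>
    (\<Sum>n. ennreal (env.P.prob {\<omega> \<in> space env.S. stays R n x \<omega>})) \<le> ennreal (K + L * ln R)"
    by (rule suminf_prob_stays_le_ln) blast
  have "Limsup at_top (\<lambda>R. enn2ereal (expected_exit_time M As Bs R x) / ereal (ln R)) \<le> ereal (\<bar>K\<bar> + \<bar>L\<bar>)"
  proof (rule Limsup_bounded)
    show "\<forall>\<^sub>F R in at_top. enn2ereal (expected_exit_time M As Bs R x) / ereal (ln R) \<le> ereal (\<bar>K\<bar> + \<bar>L\<bar>)"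
      \<comment> \<open>From here on \<open>ln R\<close> is at least 1, so the additive constant is
        absorbed into the slope.\<close>
      using eventually_ge_at_top[of "exp 1"]
    proof eventually_elim
      case (elim R)
      have "1 \<le> R" using elim one_le_exp_iff[of 1] by linarith
      have "1 \<le> ln R" using elim by (subst ln_ge_iff) (use \<open>1 \<le> R\<close> in auto)
      have "expected_exit_time M As Bs R x \<le> ennreal (K + L * ln R)"
        unfolding expected_exit_time_eq by (rule KL) fact
      also have "\<dots> \<le> ennreal ((\<bar>K\<bar> + \<bar>L\<bar>) * ln R)"
      proof (rule ennreal_leI)
        have "K \<le> \<bar>K\<bar> * ln R" "L * ln R \<le> \<bar>L\<bar> * ln R"
          using \<open>1 \<le> ln R\<close> mult_left_mono[of 1 "ln R" "\<bar>K\<bar>"] by (auto intro: mult_right_mono)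
        then show "K + L * ln R \<le> (\<bar>K\<bar> + \<bar>L\<bar>) * ln R" by (simp add: algebra_simps)
      qed
      finally have "enn2ereal (expected_exit_time M As Bs R x) \<le> ereal ((\<bar>K\<bar> + \<bar>L\<bar>) * ln R)"
        using \<open>1 \<le> ln R\<close> by (simp add: less_eq_ennreal.rep_eq)
      then show ?case
        using \<open>1 \<le> ln R\<close> by (subst ereal_divide_le_pos) (auto simp: mult.commute)
    qed
  qed
  then show ?thesis by (rule le_less_trans) simp
qed

lemma Liminf_exit_time_ge:
  assumes lim: "AE \<omega> in M. (\<lambda>n. log_growth As n \<omega> / ereal (real n)) \<longlonglongrightarrow> ereal g"
    and int: "integrable env.S (\<lambda>\<omega>. log_size (\<omega> 0))"
    and "0 < g"
  shows "1 / ereal g \<le> Liminf at_top (\<lambda>R. enn2ereal (expected_exit_time M As Bs R x) / ereal (ln R))"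
    (is "_ \<le> ?L")
proof (rule dense_le)
  fix y assume y: "y < 1 / ereal g"
  have "1 / ereal g = ereal (1 / g)" using \<open>0 < g\<close> by (simp add: one_ereal_def)
  have growth_le: "AE \<omega> in env.S. \<forall>\<^sub>F n in sequentially. norm (cocycle n \<omega>) \<le> exp (b * real n)" if "g < b" for b
  proof (subst AE_environment_iff)
    show "AE \<omega> in M. \<forall>\<^sub>F n in sequentially. norm (cocycle n (environment \<omega>)) \<le> exp (b * real n)"
      using lim
    proof eventually_elim
      case (elim \<omega>)
      then show ?case
        unfolding log_growth_eq
        by (rule eventually_norm_le_exp_if_elog_tendsto) fact
    qed
  qed (rule env.measurable_cocycle_growth)
  show "y \<le> ?L"
  proof (cases "0 < y")
    case False
    have "0 \<le> ?L"
      by (rule Liminf_bounded)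
         (use eventually_gt_at_top[of 1] in \<open>eventually_elim, auto\<close>)
    with False show ?thesis by (meson not_less order_trans)
  next
    case True
    then obtain t where t: "y = ereal t" "0 < t" "t < 1 / g"
      using y \<open>1 / ereal g = ereal (1 / g)\<close> by (cases y) auto
    then have "g < 1 / t" using \<open>0 < g\<close> by (simp add: field_simps)
    \<comment> \<open>The room between \<open>t\<close> and \<open>1 / g\<close> is shared between a
      rate \<open>b\<close> above \<open>g\<close> and a probability \<open>q\<close> below 1, so
      that the slope \<open>q / b\<close> still exceeds \<open>t\<close>. The surplus
      \<open>s\<close> below absorbs the rounding loss \<open>J * q\<close>.\<close>
    then obtain b where b: "g < b" "b < 1 / t" using dense by blast
    then have "0 < b" "t * b < 1" using \<open>0 < g\<close> \<open>0 < t\<close> by (auto simp: field_simps)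
    then obtain q where q: "t * b < q" "q < 1" using dense by blast
    have "0 \<le> t * b" using \<open>0 < b\<close> \<open>0 < t\<close> by simp
    then have "0 \<le> q" using q by linarith
    obtain J :: nat where J: "\<forall>\<^sub>F R in at_top.
        ennreal ((ln R / b - real J) * q) \<le> (\<Sum>n. ennreal (env.P.prob {\<omega> \<in> space env.S. stays R n x \<omega>}))"
      by (rule env.suminf_prob_stays_ge[OF growth_le int less_imp_le[OF \<open>0 < g\<close>] b(1) \<open>0 \<le> q\<close> q(2)])
    define s where "s = q / b - t"
    have "0 < s" using q \<open>0 < b\<close> by (simp add: s_def field_simps)
    have ev: "\<forall>\<^sub>F R::real in at_top. real J * q / s \<le> ln R"
      using ln_at_top by (auto simp: filterlim_at_top)
    show ?thesis
      unfolding t(1)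
    proof (rule Liminf_bounded)
      show "\<forall>\<^sub>F R in at_top. ereal t \<le> enn2ereal (expected_exit_time M As Bs R x) / ereal (ln R)"
        using J ev eventually_gt_at_top[of 1]
      proof eventually_elim
        case (elim R)
        have "0 < ln R" using elim by simp
        have "real J * q \<le> ln R * s"
          using elim(2) \<open>0 < s\<close> by (simp add: divide_le_eq)
        then have "t * ln R \<le> (ln R / b - real J) * q"
          using \<open>0 < b\<close> by (simp add: s_def algebra_simps)
        then have "ennreal (t * ln R) \<le> expected_exit_time M As Bs R x"
          unfolding expected_exit_time_eq using elim(1) ennreal_leI order_trans by blast
        then have "ereal (t * ln R) \<le> enn2ereal (expected_exit_time M As Bs R x)"
          using \<open>0 < ln R\<close> t(2) by (simp add: less_eq_ennreal.rep_eq)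
        then show ?case
          using \<open>0 < ln R\<close> by (subst ereal_le_divide_pos) (auto simp: mult.commute)
      qed
    qed
  qed
qed

end

theorem theorem3p7:
  fixes M :: "'a measure"
    and A :: "'a \<Rightarrow> real^'n^'n" and B :: "'a \<Rightarrow> real^'n"
    and As :: "nat \<Rightarrow> 'a \<Rightarrow> real^'n^'n" and Bs :: "nat \<Rightarrow> 'a \<Rightarrow> real^'n"
    and \<gamma> :: ereal and x\<^sub>0 :: "real^'n"
  assumes "prob_space M"
    and "A \<in> borel_measurable M" and "B \<in> borel_measurable M"
    and "iid_copies M (\<lambda>\<omega>. (A \<omega>, B \<omega>)) (\<lambda>n \<omega>. (As n \<omega>, Bs n \<omega>))"
    and "\<gamma> = lyapunov_exponent M As"
    and a1: "\<gamma> > 0"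
    and a2: "AE \<omega> in M. (\<lambda>n. log_growth As n \<omega> / ereal (real n)) \<longlonglongrightarrow> \<gamma>"
    and b1: "AE \<omega> in M. invertible (A \<omega>)"
    and b2: "irreducible_matrix M A"
    and c: "(INF x. ereal_expectation M (\<lambda>\<omega>. elog (norm (A \<omega> *v x + B \<omega> - x)))) > - \<infinity>"
    and d: "\<exists>R\<^sub>0>1. \<exists>z\<^sub>0>1. \<exists>C\<^sub>0>0. \<exists>\<beta>\<^sub>0>1. \<forall>R\<ge>R\<^sub>0. \<forall>z\<ge>z\<^sub>0. \<forall>x. norm x \<le> R \<longrightarrow>
       \<P>(\<omega> in M. norm (A \<omega> *v x + B \<omega>) > z * R)
         \<le> C\<^sub>0 / (ln z) powr \<beta>\<^sub>0 * \<P>(\<omega> in M. norm (A \<omega> *v x + B \<omega>) > R)"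
  shows "1 / \<gamma> \<le> Liminf at_top (\<lambda>R. enn2ereal (expected_exit_time M As Bs R x\<^sub>0) / ereal (ln R)) \<and>
         Liminf at_top (\<lambda>R. enn2ereal (expected_exit_time M As Bs R x\<^sub>0) / ereal (ln R))
           \<le> Limsup at_top (\<lambda>R. enn2ereal (expected_exit_time M As Bs R x\<^sub>0) / ereal (ln R)) \<and>
         Limsup at_top (\<lambda>R. enn2ereal (expected_exit_time M As Bs R x\<^sub>0) / ereal (ln R)) < \<infinity>"
proof -
  let ?Q = "\<lambda>R. enn2ereal (expected_exit_time M As Bs R x\<^sub>0) / ereal (ln R)"
  interpret affine_recursion M A B As Bs
    using assms(1-4) by (intro affine_recursion.intro affine_recursion_axioms.intro)
  obtain c' :: real where c': "0 < c'" "ereal c' < \<gamma>"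
    using a1 by (metis ereal_dense2 ereal_less(2))
  have "Limsup at_top ?Q < \<infinity>"
    by (rule Limsup_exit_time_less_infinity) (rule expanding_affine_law[OF a2 b2 c c'])
  moreover have "Liminf at_top ?Q \<le> Limsup at_top ?Q"
    by (rule Liminf_le_Limsup) simp
  moreover have "1 / \<gamma> \<le> Liminf at_top ?Q"
  proof (cases \<gamma>)
    case (real g)
    obtain R\<^sub>0 z\<^sub>0 C\<^sub>0 \<beta>\<^sub>0 :: real where "1 < R\<^sub>0" "1 < z\<^sub>0" "0 < C\<^sub>0" "1 < \<beta>\<^sub>0"
      and tail: "\<forall>R\<ge>R\<^sub>0. \<forall>z\<ge>z\<^sub>0. \<forall>x. norm x \<le> R \<longrightarrow>
        \<P>(\<omega> in M. norm (A \<omega> *v x + B \<omega>) > z * R)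
          \<le> C\<^sub>0 / (ln z) powr \<beta>\<^sub>0 * \<P>(\<omega> in M. norm (A \<omega> *v x + B \<omega>) > R)"
      using d by (elim exE conjE)
    have "integrable env.S (\<lambda>\<omega>. log_size (\<omega> 0))"
    proof (rule integrable_log_size)
      fix z and x :: "real^'n" assume z: "z\<^sub>0 \<le> z" and x: "norm x \<le> R\<^sub>0"
      \<comment> \<open>At \<open>R = R\<^sub>0\<close> the probability on the right of condition
        (d) is bounded by 1, which leaves a pure tail bound.\<close>
      have "0 \<le> C\<^sub>0 / (ln z) powr \<beta>\<^sub>0" using \<open>0 < C\<^sub>0\<close> by simp
      from order_trans[OF tail[rule_format, OF order_refl z x] mult_left_le[OF prob_le_1 this]]
      show "prob {\<omega> \<in> space M. z * R\<^sub>0 < norm (A \<omega> *v x + B \<omega>)} \<le> C\<^sub>0 / (ln z) powr \<beta>\<^sub>0" .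
    qed (use \<open>1 < R\<^sub>0\<close> \<open>0 < C\<^sub>0\<close> \<open>1 < \<beta>\<^sub>0\<close> in auto)
    then show ?thesis
      using a1 a2 unfolding real by (intro Liminf_exit_time_ge) auto
  next
    \<comment> \<open>Here \<open>1 / \<gamma>\<close> is 0, so the claim is that the quotient is
      eventually nonnegative.\<close>
    case PInf
    have "0 \<le> Liminf at_top ?Q"
      by (rule Liminf_bounded)
         (use eventually_gt_at_top[of 1] in \<open>eventually_elim, auto\<close>)
    then show ?thesis by (simp add: PInf)
  qed (use a1 in auto)
  ultimately show ?thesis by blast
qed

end
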